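(* Let $R$ be an infinite relational structure with a finite monomorphic decomposition, and let $k$ be its monomorphic dimension. Then the generating series $\mathcal H_R(Z)=\sum_{n\ge 0}\varphi_R(n)Z^n$ of the profile of $R$ is a rational fraction of the form $$\mathcal H_R(Z)=\frac{P(Z)}{(1-Z)(1-Z^2)\cdots(1-Z^k)},$$ with $P\in\mathbb Z[Z]$ and $P(1)\neq 0$. In particular, $\varphi_R$ is eventually a quasi-polynomial of degree $k-1$, hence $\varphi_R(n)\sim a n^{k-1}$ for some positive real number $a$.
   Context: A relational structure is a pair $R=(E,(\rho_i)_{i\in I})$ where $E$ is a set and each $\rho_i$ is an $m_i$-ary relation on $E$ ($I$ may be infinite); $R$ is infinite if $E$ is infinite. The restriction of $R$ to $A\subseteq E$ is $R_{\restriction A}=(A,(A^{m_i}\cap\rho_i)_{i\in I})$. The profile $\varphi_R$ of $R$ is the function where $\varphi_R(n)$ is the number of isomorphism types of restrictions of $R$ to $n$-element subsets of $E$. A set partition $(E_x)_{x\in X}$ of $E$ is a monomorphic decomposition of $R$ if, for any two finite subsets $A,A'$ of $E$ such that $|A\cap E_x|=|A'\cap E_x|$ for all $x\in X$, the restrictions $R_{\restriction A}$ and $R_{\restriction A'}$ are isomorphic. It is finite if $X$ is finite. There is a (unique) monomorphic decomposition of $R$, called minimal, such that every monomorphic decomposition of $R$ is a refinement of it; the monomorphic dimension of $R$ is the number of infinite blocks of the minimal monomorphic decomposition. A map $\varphi:\mathbb N\to\mathbb N$ is a quasi-polynomial of degree $k$ if $\varphi(n)=a_k(n)n^k+\cdots+a_0(n)$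 where the coefficients $a_k(n),\dots,a_0(n)$ are periodic functions of $n$ (with $a_k$ not identically zero). "Eventually" means for all $n$ large enough. *)

theory Defs
  imports
    "HOL-Library.Disjoint_Sets"
    "HOL-Library.Landau_Symbols"
    "HOL-Computational_Algebra.Computational_Algebra"
begin

text \<open>An \<open>m\<close>-tuple over \<open>A\<close> is a list of length \<open>m\<close> with entries in \<open>A\<close>.\<close>

definition tuples :: "nat \<Rightarrow> 'a set \<Rightarrow> 'a list set" where
  "tuples m A = {xs. length xs = m \<and> set xs \<subseteq> A}"

record ('a, 'i) structure_data =
  base :: "'a set"
  index_set :: "'i set"
  arity :: "'i \<Rightarrow> nat"
  rel :: "'i \<Rightarrow> 'a list set"

definition relational_structure :: "('a, 'i) structure_data \<Rightarrow> bool" where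
  "relational_structure R \<longleftrightarrow> (\<forall>i\<in>index_set R. rel R i \<subseteq> tuples (arity R i) (base R))"

definition restriction :: "('a, 'i) structure_data \<Rightarrow> 'a set \<Rightarrow> ('a, 'i) structure_data" where
  "restriction R A = R\<lparr>base := A, rel := (\<lambda>i. tuples (arity R i) A \<inter> rel R i)\<rparr>"

definition isomorphic :: "('a, 'i) structure_data \<Rightarrow> ('b, 'i) structure_data \<Rightarrow> bool" where
  "isomorphic R S \<longleftrightarrow>
     index_set R = index_set S \<and>
     (\<forall>i\<in>index_set R. arity R i = arity S i) \<and>
     (\<exists>f. bij_betw f (base R) (base S) \<and>
          (\<forall>i\<in>index_set R. \<forall>xs\<in>tuples (arity R i) (base R).
             xs \<in> rel R i \<longleftrightarrow> map f xs \<in> rel S i))"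

definition subsets_of_size :: "('a, 'i) structure_data \<Rightarrow> nat \<Rightarrow> 'a set set" where
  "subsets_of_size R n = {A. A \<subseteq> base R \<and> finite A \<and> card A = n}"

definition same_type :: "('a, 'i) structure_data \<Rightarrow> nat \<Rightarrow> ('a set \<times> 'a set) set" where
  "same_type R n = {(A, B). A \<in> subsets_of_size R n \<and> B \<in> subsets_of_size R n \<and>
                      isomorphic (restriction R A) (restriction R B)}"

text \<open>Isomorphism types are represented by the classes of \<open>n\<close>-element subsets inducing
  isomorphic restrictions. As \<open>card\<close> is \<open>0\<close> on infinite sets, \<open>profile\<close> is meaningful only if
  there are finitely many types; \<open>finite_isomorphism_types\<close> below shows that this is the case
  when there is a finite monomorphic decomposition.\<close>

definition isomorphism_types :: "('a, 'i) structure_data \<Rightarrow> nat \<Rightarrow> 'a set set set" where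
  "isomorphism_types R n = subsets_of_size R n // same_type R n"

definition profile :: "('a, 'i) structure_data \<Rightarrow> nat \<Rightarrow> nat" where
  "profile R n = card (isomorphism_types R n)"

text \<open>A decomposition is given as the set of its blocks, which are nonempty by
  \<open>partition_on\<close>.\<close>

definition monomorphic_decomposition :: "('a, 'i) structure_data \<Rightarrow> 'a set set \<Rightarrow> bool" where
  "monomorphic_decomposition R D \<longleftrightarrow>
     partition_on (base R) D \<and>
     (\<forall>A A'. A \<subseteq> base R \<and> finite A \<and> A' \<subseteq> base R \<and> finite A' \<and>
             (\<forall>B\<in>D. card (A \<inter> B) = card (A' \<inter> B)) \<longrightarrow>
             isomorphic (restriction R A) (restriction R A'))"

definition minimal_monomorphic_decomposition :: "('a, 'i) structure_data \<Rightarrow> 'a set set" where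
  "minimal_monomorphic_decomposition R =
     (THE D. monomorphic_decomposition R D \<and>
             (\<forall>D'. monomorphic_decomposition R D' \<longrightarrow> refines (base R) D' D))"

definition monomorphic_dimension :: "('a, 'i) structure_data \<Rightarrow> nat" where
  "monomorphic_dimension R = card {B \<in> minimal_monomorphic_decomposition R. infinite B}"

definition periodic :: "(nat \<Rightarrow> 'c) \<Rightarrow> bool" where
  "periodic f \<longleftrightarrow> (\<exists>p>0. \<forall>n. f (n + p) = f n)"

definition quasi_polynomial :: "nat \<Rightarrow> (nat \<Rightarrow> real) \<Rightarrow> bool" where
  "quasi_polynomial d f \<longleftrightarrow>
     (\<exists>a :: nat \<Rightarrow> nat \<Rightarrow> real.
        (\<forall>j\<le>d. periodic (a j)) \<and> (\<exists>n. a d n \<noteq> 0) \<and>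
        (\<forall>n. f n = (\<Sum>j\<le>d. a j n * real n ^ j)))"

definition eventually_quasi_polynomial :: "nat \<Rightarrow> (nat \<Rightarrow> nat) \<Rightarrow> bool" where
  "eventually_quasi_polynomial d f \<longleftrightarrow>
     (\<exists>q. quasi_polynomial d q \<and> (\<forall>\<^sub>F n in sequentially. real (f n) = q n))"

definition profile_series :: "('a, 'i) structure_data \<Rightarrow> rat fps" where
  "profile_series R = Abs_fps (\<lambda>n. of_nat (profile R n))"

lemma isomorphic_refl: "isomorphic R R"
  unfolding isomorphic_def by (auto intro!: exI[of _ id] simp: bij_betw_def)

lemma isomorphic_sym:
  assumes "isomorphic R S"
  shows "isomorphic S R"
proof -
  from assms obtain f where f: "bij_betw f (base R) (base S)"
    and fr: "\<And>i xs. i \<in> index_set R \<Longrightarrow> xs \<in> tuples (arity R i) (base R) \<Longrightarrow>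
               xs \<in> rel R i \<longleftrightarrow> map f xs \<in> rel S i"
    and ix: "index_set R = index_set S" "\<And>i. i \<in> index_set R \<Longrightarrow> arity R i = arity S i"
    unfolding isomorphic_def by blast
  let ?g = "inv_into (base R) f"
  have g: "bij_betw ?g (base S) (base R)" using f by (rule bij_betw_inv_into)
  have "xs \<in> rel S i \<longleftrightarrow> map ?g xs \<in> rel R i"
    if i: "i \<in> index_set S" and xs: "xs \<in> tuples (arity S i) (base S)" for i xs
  proof -
    have "map ?g xs \<in> tuples (arity R i) (base R)"
      using bij_betwE[OF g] xs ix i by (auto simp: tuples_def)
    then have "map ?g xs \<in> rel R i \<longleftrightarrow> map f (map ?g xs) \<in> rel S i"
      using fr i ix by blast
    moreover have "map f (map ?g xs) = xs"
      using xs f by (auto simp: tuples_def bij_betw_inv_into_right intro!: map_idI)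
    ultimately show ?thesis by simp
  qed
  with g ix show ?thesis unfolding isomorphic_def by auto
qed

lemma isomorphic_trans:
  assumes "isomorphic R S" "isomorphic S T"
  shows "isomorphic R T"
proof -
  from assms(1) obtain f where f: "bij_betw f (base R) (base S)"
    and fr: "\<And>i xs. i \<in> index_set R \<Longrightarrow> xs \<in> tuples (arity R i) (base R) \<Longrightarrow>
               xs \<in> rel R i \<longleftrightarrow> map f xs \<in> rel S i"
    and ix: "index_set R = index_set S" "\<And>i. i \<in> index_set R \<Longrightarrow> arity R i = arity S i"
    unfolding isomorphic_def by blast
  from assms(2) obtain g where g: "bij_betw g (base S) (base T)"
    and gr: "\<And>i xs. i \<in> index_set S \<Longrightarrow> xs \<in> tuples (arity S i) (base S) \<Longrightarrow>
               xs \<in> rel S i \<longleftrightarrow> map g xs \<in> rel T i"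
    and jx: "index_set S = index_set T" "\<And>i. i \<in> index_set S \<Longrightarrow> arity S i = arity T i"
    unfolding isomorphic_def by blast
  have "xs \<in> rel R i \<longleftrightarrow> map (g \<circ> f) xs \<in> rel T i"
    if i: "i \<in> index_set R" and xs: "xs \<in> tuples (arity R i) (base R)" for i xs
  proof -
    have "map f xs \<in> tuples (arity S i) (base S)"
      using bij_betwE[OF f] xs ix i by (auto simp: tuples_def)
    then show ?thesis using fr[OF i xs] gr[of i "map f xs"] i ix by simp
  qed
  moreover have "bij_betw (g \<circ> f) (base R) (base T)" using f g by (rule bij_betw_trans)
  ultimately show ?thesis using ix jx unfolding isomorphic_def by auto
qed

lemma equiv_same_type: "equiv (subsets_of_size R n) (same_type R n)"
  unfolding equiv_def refl_on_def sym_def trans_def same_type_def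
  by (auto intro: isomorphic_refl isomorphic_sym isomorphic_trans)

lemma finite_isomorphism_types:
  assumes D: "monomorphic_decomposition R D" and "finite D"
  shows "finite (isomorphism_types R n)"
proof -
  let ?c = "\<lambda>A. restrict (\<lambda>B. card (A \<inter> B)) D"
  let ?S = "subsets_of_size R n"
  have "?c ` ?S \<subseteq> D \<rightarrow>\<^sub>E {..n}"
    by (auto simp: subsets_of_size_def intro: card_mono)
  then have fin: "finite (?c ` ?S)"
    using \<open>finite D\<close> by (meson finite_PiE finite_atMost finite_subset)
  have "same_type R n `` {A} = same_type R n `` {A'}"
    if "A \<in> ?S" "A' \<in> ?S" "?c A = ?c A'" for A A'
  proof -
    have "\<forall>B\<in>D. card (A \<inter> B) = card (A' \<inter> B)"
      using that(3) by (metis (mono_tags, lifting) restrict_apply')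
    then have "(A, A') \<in> same_type R n"
      using D that by (auto simp: monomorphic_decomposition_def same_type_def subsets_of_size_def)
    then show ?thesis using equiv_same_type equiv_class_eq by metis
  qed
  then have "\<exists>h. \<forall>A\<in>?S. same_type R n `` {A} = h (?c A)"
    by (intro exI[of _ "\<lambda>v. same_type R n `` {SOME A. A \<in> ?S \<and> ?c A = v}"])
       (smt (verit, best) someI_ex)
  then obtain h where "\<forall>A\<in>?S. same_type R n `` {A} = h (?c A)" ..
  then have "isomorphism_types R n \<subseteq> h ` ?c ` ?S"
    by (auto simp: isomorphism_types_def quotient_def)
  then show ?thesis using fin by (meson finite_imageI finite_subset)
qed

end

theory Submission
  imports Defs "HOL-Library.Fun_Lexorder"
begin

text \<open>
  Two finite subsets that meet every block of a finite monomorphic decomposition in equally many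
  points induce isomorphic restrictions, so a restriction is described by its \<^emph>\<open>shape\<close>,
  the vector of these numbers, and the profile counts classes of shapes. In every class one shape is
  singled out, the \<^emph>\<open>leading\<close> one: as unbalanced as possible, which is measured by the energy
  \<open>\<Sum>i<m. (m + 2) ^ d i\<close>, with ties broken lexicographically. The profile at \<open>n\<close> is the number of leading
  shapes of size \<open>n\<close> (\<open>profile_eq_card_leading\<close>).

  The set of leading shapes is closed under a simple operation (\<open>leading_raise_layer\<close>): if the layer
  \<open>{i. t \<le> d i}\<close> of a leading shape \<open>d\<close> consists of infinite blocks, then adding one point to every
  block of the layer gives a leading shape. Indeed, let \<open>A\<close> have the new shape. Moving one point from a
  smaller to a larger block increases the energy, so, as \<open>d\<close> is leading, a point of \<open>A\<close> in a block of the
  layer cannot be exchanged, inside \<open>A\<close>, for a point in another block. An isomorphism from a set \<open>B\<close> with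
  a better shape onto \<open>A\<close> preserves exchangeability and thus respects these blocks; removing one point
  from each of them, on both sides, turns it into an isomorphism showing that \<open>d\<close> is not leading.

  A shape is determined by its truncation at some height \<open>K\<close>, by the decreasing chain of its layers above
  \<open>K\<close>, and by their multiplicities. If \<open>K\<close> is at least the size of every finite block, there are only
  finitely many truncations and chains, and for fixed ones the multiplicity vectors of leading shapes
  form an up-closed set of integer vectors. By the ascending chain condition for such sets, their
  counting series is a polynomial over \<open>\<Prod>S. 1 - Z ^ card S\<close>, where \<open>S\<close> ranges over the chain
  (\<open>counting_series_up_closed\<close>). The members of a chain have distinct sizes between \<open>1\<close> and the number
  \<open>k\<close> of infinite blocks, so \<open>\<Prod>i=1..k. 1 - Z ^ i\<close> is a common denominator.

  For the growth, \<open>\<Prod>i=1..k. 1 - Z ^ i\<close> divides \<open>(1 - Z) * (1 - Z ^ l) ^ (k - 1)\<close> with \<open>l = k!\<close>, and the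
  coefficients of the inverse of the latter are \<open>(n div l + k - 1) choose (k - 1)\<close>. Keeping one factor
  \<open>1 - Z\<close> makes the coefficient of \<open>n ^ (k - 1)\<close> the same in all residue classes; it is a positive
  multiple of \<open>P(1)\<close>. It does not vanish because the profile grows at least like \<open>n ^ (k - 1)\<close>
  (\<open>profile_lower_bound\<close>): in the minimal decomposition, points of different blocks are not
  exchangeable, and this is already witnessed inside every set that is large enough in each block. An
  isomorphism between two such sets permutes the blocks, so only boundedly many of their
  shapes induce the same isomorphism type.
\<close>

section \<open>Counting series of up-closed sets\<close>

definition counting_series :: "('b \<Rightarrow> nat) \<Rightarrow> 'b set \<Rightarrow> int fps" where
  "counting_series deg U = Abs_fps (\<lambda>n. int (card {u \<in> U. deg u = n}))"

lemma counting_series_Un: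
  assumes "\<And>n. finite {u \<in> U. deg u = n}" "\<And>n. finite {u \<in> V. deg u = n}" "U \<inter> V = {}"
  shows "counting_series deg (U \<union> V) = counting_series deg U + counting_series deg V"
proof -
  have "card {u \<in> U \<union> V. deg u = n} = card {u \<in> U. deg u = n} + card {u \<in> V. deg u = n}" for n
  proof -
    have "{u \<in> U \<union> V. deg u = n} = {u \<in> U. deg u = n} \<union> {u \<in> V. deg u = n}" by auto
    then show ?thesis using assms by (simp add: card_Un_disjoint disjoint_iff)
  qed
  then show ?thesis by (simp add: counting_series_def fps_eq_iff)
qed

lemma counting_series_UN:
  assumes "finite J" "\<And>j n. j \<in> J \<Longrightarrow> finite {u \<in> A j. deg u = n}" "disjoint_family_on A J"
  shows "counting_series deg (\<Union>j\<in>J. A j) = (\<Sum>j\<in>J. counting_series deg (A j))"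
  using assms
proof (induction J rule: finite_induct)
  case empty
  then show ?case by (simp add: counting_series_def fps_eq_iff)
next
  case (insert x F)
  have fin: "finite {u \<in> (\<Union>j\<in>F. A j). deg u = n}" for n
  proof -
    have "{u \<in> (\<Union>j\<in>F. A j). deg u = n} = (\<Union>j\<in>F. {u \<in> A j. deg u = n})" by auto
    then show ?thesis using insert by simp
  qed
  have "A x \<inter> A j = {}" if "j \<in> F" for j
    by (rule disjoint_family_onD[OF insert.prems(2)]) (use that insert.hyps(2) in auto)
  then have "A x \<inter> (\<Union>j\<in>F. A j) = {}" by blast
  moreover have "disjoint_family_on A F"
    by (rule disjoint_family_on_mono[OF _ insert.prems(2)]) blast
  ultimately show ?case using insert fin by (simp add: counting_series_Un)
qed

lemma counting_series_image:
  assumes "inj_on f U" "\<And>u. u \<in> U \<Longrightarrow> deg' (f u) = deg u + c"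
  shows "counting_series deg' (f ` U) = fps_X ^ c * counting_series deg U"
proof -
  have "card {u \<in> f ` U. deg' u = n} = (if n < c then 0 else card {u \<in> U. deg u = n - c})" for n
  proof (cases "n < c")
    case True
    then have e: "{u \<in> f ` U. deg' u = n} = {}" using assms(2) by auto
    show ?thesis unfolding e using True by simp
  next
    case False
    then have "{u \<in> f ` U. deg' u = n} = f ` {u \<in> U. deg u = n - c}" using assms(2) by auto
    moreover have "inj_on f {u \<in> U. deg u = n - c}" using assms(1) by (rule inj_on_subset) auto
    ultimately show ?thesis using False by (simp add: card_image)
  qed
  then show ?thesis
    by (simp add: counting_series_def fps_eq_iff fps_X_power_mult_nth)
qed

text \<open>Vectors are functions that vanish outside \<open>I\<close>, so each vector indexed by \<open>I\<close> is represented once.\<close>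

definition up_closed :: "'b set \<Rightarrow> ('b \<Rightarrow> nat) set \<Rightarrow> bool" where
  "up_closed I U \<longleftrightarrow> (\<forall>n\<in>U. (\<forall>i. i \<notin> I \<longrightarrow> n i = 0) \<and> (\<forall>i\<in>I. n(i := Suc (n i)) \<in> U))"

text \<open>The coordinate \<open>j\<close> is reset to \<open>0\<close>, which makes slices at different heights comparable: in an up-closed
  set they increase with the height.\<close>

definition slice :: "'b \<Rightarrow> nat \<Rightarrow> ('b \<Rightarrow> nat) set \<Rightarrow> ('b \<Rightarrow> nat) set" where
  "slice j b U = {n. n j = 0 \<and> n(j := b) \<in> U}"

lemma up_closed_slice:
  assumes "up_closed (insert j I) U" "j \<notin> I"
  shows "up_closed I (slice j b U)"
  unfolding up_closed_def
proof (intro ballI conjI allI impI)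
  fix n i assume n: "n \<in> slice j b U"
  then have nj: "n j = 0" "n(j := b) \<in> U" by (auto simp: slice_def)
  show "n i = 0" if "i \<notin> I"
  proof (cases "i = j")
    case False
    then have "(n(j := b)) i = 0" using nj that assms(1) unfolding up_closed_def by blast
    then show ?thesis using False by simp
  qed (simp add: nj)
  show "n(i := Suc (n i)) \<in> slice j b U" if i: "i \<in> I"
  proof -
    have "i \<noteq> j" using i assms(2) by auto
    have "(n(j := b))(i := Suc ((n(j := b)) i)) \<in> U"
      using nj i assms(1) unfolding up_closed_def by blast
    moreover have "(n(j := b))(i := Suc ((n(j := b)) i)) = (n(i := Suc (n i)))(j := b)"
      using \<open>i \<noteq> j\<close> by auto
    ultimately show ?thesis using nj \<open>i \<noteq> j\<close> by (simp add: slice_def)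
  qed
qed

lemma slice_mono: "U \<subseteq> V \<Longrightarrow> slice j b U \<subseteq> slice j b V"
  by (auto simp: slice_def)

lemma slice_Suc:
  assumes "up_closed (insert j I) U"
  shows "slice j b U \<subseteq> slice j (Suc b) U"
proof
  fix n assume "n \<in> slice j b U"
  then have nj: "n j = 0" "n(j := b) \<in> U" by (auto simp: slice_def)
  then have "(n(j := b))(j := Suc ((n(j := b)) j)) \<in> U"
    using assms unfolding up_closed_def by blast
  then show "n \<in> slice j (Suc b) U" using nj by (simp add: slice_def)
qed

lemma slice_le:
  assumes "up_closed (insert j I) U" "b \<le> c"
  shows "slice j b U \<subseteq> slice j c U"
  using lift_Suc_mono_le[of "\<lambda>b. slice j b U"] slice_Suc[OF assms(1)] assms(2) by blast

lemma mem_slice_iff: "n \<in> U \<longleftrightarrow> n(j := 0) \<in> slice j (n j) U"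
  by (simp add: slice_def)

text \<open>This is Dickson's lemma in the form of an ascending chain condition. In the induction step, the slices
  \<open>T a b\<close> of \<open>V a\<close> at height \<open>b\<close> increase in both arguments. If the diagonal is constant from \<open>M\<close> on,
  monotonicity squeezes all \<open>T a b\<close> with \<open>a, b \<ge> M\<close> to one value, and each of the finitely many
  remaining heights \<open>b < M\<close> stabilises by the induction hypothesis.\<close>

lemma up_closed_chain_stabilises:
  assumes "finite I" "\<And>a. up_closed I (V a)" "incseq V"
  shows "\<exists>M. \<forall>a\<ge>M. V a = V M"
  using assms
proof (induction I arbitrary: V rule: finite_induct)
  case empty
  have sub: "V a \<subseteq> {\<lambda>_. 0}" for a
    using empty(1)[of a] unfolding up_closed_def by auto
  show ?case
  proof (cases "\<forall>a. V a = {}")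
    case False
    then obtain M where "V M \<noteq> {}" by auto
    then have "V a = {\<lambda>_. 0}" if "a \<ge> M" for a
      using sub[of a] sub[of M] incseqD[OF empty(2) that] by auto
    then show ?thesis by blast
  qed auto
next
  case (insert j I)
  let ?T = "\<lambda>a b. slice j b (V a)"
  have up: "up_closed I (?T a b)" for a b
    using up_closed_slice insert by metis
  have mono: "?T a b \<subseteq> ?T a' b'" if "a \<le> a'" "b \<le> b'" for a a' b b'
  proof -
    have "?T a b \<subseteq> ?T a' b" using incseqD[OF insert.prems(2) that(1)] by (rule slice_mono)
    also have "\<dots> \<subseteq> ?T a' b'" using slice_le[OF insert.prems(1) that(2)] .
    finally show ?thesis .
  qed
  have "\<exists>M. \<forall>a\<ge>M. ?T a a = ?T M M"
    by (intro insert.IH up) (unfold incseq_def, intro allI impI mono, auto)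
  then obtain M where M: "\<And>a. a \<ge> M \<Longrightarrow> ?T a a = ?T M M" by blast
  have "\<exists>N. \<forall>a\<ge>N. ?T a b = ?T N b" for b
    by (intro insert.IH up) (unfold incseq_def, intro allI impI mono, auto)
  then obtain N where N: "\<And>a b. a \<ge> N b \<Longrightarrow> ?T a b = ?T (N b) b" by metis
  define K where "K = Max (insert M (N ` {..<M}))"
  have K: "M \<le> K" "\<And>b. b < M \<Longrightarrow> N b \<le> K" by (auto simp: K_def)
  have eq: "?T a b = ?T K b" if a: "a \<ge> K" for a b
  proof (cases "b < M")
    case True
    then show ?thesis using N[of b a] N[of b K] K(2)[OF True] a by simp
  next
    case False
    have diag: "?T c b = ?T M M" if "c \<ge> M" for c
    proof
      show "?T M M \<subseteq> ?T c b" by (intro mono) (use that False in auto)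
      have "?T c b \<subseteq> ?T (max c b) (max c b)" by (intro mono) auto
      also have "\<dots> = ?T M M" by (rule M) (use that in auto)
      finally show "?T c b \<subseteq> ?T M M" .
    qed
    show ?thesis using diag[of a] diag[of K] a K(1) by simp
  qed
  have "V a = V K" if a: "a \<ge> K" for a
  proof (rule set_eqI)
    fix n
    have "n \<in> V a \<longleftrightarrow> n(j := 0) \<in> slice j (n j) (V a)" by (rule mem_slice_iff)
    also have "\<dots> \<longleftrightarrow> n(j := 0) \<in> slice j (n j) (V K)" using eq[OF a] by simp
    also have "\<dots> \<longleftrightarrow> n \<in> V K" by (rule mem_slice_iff[symmetric])
    finally show "n \<in> V a \<longleftrightarrow> n \<in> V K" .
  qed
  then show ?case by blast
qed

abbreviation weight :: "('b \<Rightarrow> nat) \<Rightarrow> 'b set \<Rightarrow> ('b \<Rightarrow> nat) \<Rightarrow> nat" where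
  "weight w I n \<equiv> (\<Sum>i\<in>I. w i * n i)"

lemma finite_weight_fibre:
  assumes "finite I" "\<And>i. i \<in> I \<Longrightarrow> w i > 0" "up_closed I U"
  shows "finite {n \<in> U. weight w I n = N}"
proof (rule finite_subset)
  show "{n \<in> U. weight w I n = N} \<subseteq> {n. \<forall>i. (i \<in> I \<longrightarrow> n i \<in> {..N}) \<and> (i \<notin> I \<longrightarrow> n i = 0)}"
  proof (intro subsetI CollectI allI conjI impI)
    fix n i assume n: "n \<in> {n \<in> U. weight w I n = N}"
    show "n i = 0" if "i \<notin> I" using n that assms(3) unfolding up_closed_def by blast
    show "n i \<in> {..N}" if i: "i \<in> I"
    proof -
      have "n i \<le> w i * n i" using assms(2)[OF i] by simp
      also have "\<dots> \<le> weight w I n" using assms(1) i by (intro member_le_sum) auto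
      finally show ?thesis using n by simp
    qed
  qed
  show "finite {n. \<forall>i. (i \<in> I \<longrightarrow> n i \<in> {..N}) \<and> (i \<notin> I \<longrightarrow> n i = (0::nat))}"
    using assms(1) by (intro finite_set_of_finite_funs) auto
qed

abbreviation is_polynomial :: "'a::comm_ring_1 fps \<Rightarrow> bool" where
  "is_polynomial F \<equiv> F \<in> range fps_of_poly"

lemma is_polynomial_0: "is_polynomial (0::'a::comm_ring_1 fps)"
  by (metis fps_of_poly_0 rangeI)

lemma is_polynomial_1: "is_polynomial (1::'a::comm_ring_1 fps)"
  by (metis fps_of_poly_1 rangeI)

lemma is_polynomial_X_power: "is_polynomial (fps_X ^ n :: 'a::comm_ring_1 fps)"
  by (metis fps_of_poly_monom' rangeI)

lemma is_polynomial_add: "is_polynomial F \<Longrightarrow> is_polynomial G \<Longrightarrow> is_polynomial (F + G)"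
  by (auto simp flip: fps_of_poly_add)

lemma is_polynomial_diff: "is_polynomial F \<Longrightarrow> is_polynomial G \<Longrightarrow> is_polynomial (F - G)"
  by (auto simp flip: fps_of_poly_diff)

lemma is_polynomial_mult: "is_polynomial F \<Longrightarrow> is_polynomial G \<Longrightarrow> is_polynomial (F * G)"
  by (auto simp flip: fps_of_poly_mult)

lemmas is_polynomial_intros = is_polynomial_0 is_polynomial_1 is_polynomial_X_power

lemma is_polynomial_sum:
  "(\<And>i. i \<in> A \<Longrightarrow> is_polynomial (F i)) \<Longrightarrow> is_polynomial (\<Sum>i\<in>A. F i :: 'a::comm_ring_1 fps)"
  by (induction A rule: infinite_finite_induct) (auto intro: is_polynomial_intros is_polynomial_add)

lemma is_polynomial_prod:
  "(\<And>i. i \<in> A \<Longrightarrow> is_polynomial (F i)) \<Longrightarrow> is_polynomial (\<Prod>i\<in>A. F i :: 'a::comm_ring_1 fps)"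
  by (induction A rule: infinite_finite_induct) (auto intro: is_polynomial_intros is_polynomial_mult)

text \<open>Induction on the number of coordinates. The slices along coordinate \<open>j\<close> are constant from some height
  \<open>M\<close> on, so the part above \<open>M\<close> consists of the slice at \<open>M\<close> and a copy of itself shifted by one, which
  contributes a single factor \<open>1 / (1 - X ^ w j)\<close>; below \<open>M\<close> there are finitely many slices.\<close>

lemma counting_series_up_closed:
  assumes "finite I" "\<And>i. i \<in> I \<Longrightarrow> w i > 0" "up_closed I U"
  shows "is_polynomial (counting_series (weight w I) U * (\<Prod>i\<in>I. 1 - fps_X ^ w i))"
  using assms
proof (induction I arbitrary: U rule: finite_induct)
  case empty
  have "U \<subseteq> {\<lambda>_. 0}" using empty(2) unfolding up_closed_def by auto
  then consider "U = {}" | "U = {\<lambda>_. 0}" by blast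
  then have "counting_series (weight w {}) U = 0 \<or> counting_series (weight w {}) U = 1"
    by cases (auto simp: counting_series_def fps_eq_iff)
  then show ?case by (auto intro: is_polynomial_intros)
next
  case (insert j I)
  let ?I = "insert j I" let ?S = "counting_series (weight w ?I)"
  let ?D = "\<Prod>i\<in>I. 1 - fps_X ^ w i :: int fps"
  have wj: "w j > 0" using insert by simp
  have fin: "finite {n \<in> V. weight w ?I n = N}" if "V \<subseteq> U" for V N
    by (rule finite_subset[OF _ finite_weight_fibre[where U=U and I="?I" and w=w and N=N]])
       (use that insert in auto)
  have up: "up_closed I (slice j a U)" for a
    using up_closed_slice insert by metis
  have "\<exists>M. \<forall>a\<ge>M. slice j a U = slice j M U"
    using up_closed_chain_stabilises[OF insert(1), of "\<lambda>a. slice j a U"] up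
      slice_le[OF insert.prems(2)] by (simp add: incseq_def)
  then obtain M where M: "\<And>a. a \<ge> M \<Longrightarrow> slice j a U = slice j M U" by blast
  define lev where "lev a = {n \<in> U. n j = a}" for a
  define tl where "tl = {n \<in> U. n j \<ge> M}"
  have lev: "?S (lev a) = fps_X ^ (w j * a) * counting_series (weight w I) (slice j a U)" for a
  proof -
    let ?f = "\<lambda>n. n(j := a)"
    have "lev a = ?f ` slice j a U"
    proof
      show "lev a \<subseteq> ?f ` slice j a U"
      proof
        fix n assume "n \<in> lev a"
        then show "n \<in> ?f ` slice j a U"
          by (intro image_eqI[of _ _ "n(j := 0)"]) (auto simp: lev_def slice_def)
      qed
    qed (auto simp: lev_def slice_def)
    moreover have "inj_on ?f (slice j a U)"
    proof (rule inj_onI)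
      fix n n' assume a: "n \<in> slice j a U" "n' \<in> slice j a U" "n(j := a) = n'(j := a)"
      show "n = n'"
      proof
        fix x show "n x = n' x"
          using a by (cases "x = j") (auto simp: slice_def dest: fun_cong[of _ _ x])
      qed
    qed
    moreover have "weight w ?I (?f n) = weight w I n + w j * a" for n
    proof -
      have "(\<Sum>i\<in>I. w i * (?f n) i) = weight w I n"
        using insert(2) by (intro sum.cong) auto
      then show ?thesis using insert(1,2) by simp
    qed
    ultimately show ?thesis by (simp add: counting_series_image)
  qed
  have U: "U = (\<Union>a\<in>{..<M}. lev a) \<union> tl" by (auto simp: lev_def tl_def)
  have "?S U = (\<Sum>a<M. ?S (lev a)) + ?S tl"
  proof -
    have "?S (\<Union>a\<in>{..<M}. lev a) = (\<Sum>a<M. ?S (lev a))"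
      by (intro counting_series_UN fin) (auto simp: lev_def disjoint_family_on_def)
    moreover have "?S ((\<Union>a\<in>{..<M}. lev a) \<union> tl) = ?S (\<Union>a\<in>{..<M}. lev a) + ?S tl"
      by (intro counting_series_Un fin) (auto simp: lev_def tl_def)
    ultimately show ?thesis using U by simp
  qed
  moreover have "?S tl = ?S (lev M) + fps_X ^ w j * ?S tl"
  proof -
    let ?f = "\<lambda>n. n(j := Suc (n j))"
    have "tl = lev M \<union> ?f ` tl"
    proof
      show "lev M \<union> ?f ` tl \<subseteq> tl"
        using insert.prems(2) by (auto simp: lev_def tl_def up_closed_def)
      show "tl \<subseteq> lev M \<union> ?f ` tl"
      proof
        fix n assume n: "n \<in> tl"
        show "n \<in> lev M \<union> ?f ` tl"
        proof (cases "n j = M")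
          case False
          then have j: "n j - 1 \<ge> M" "n j \<ge> 1" "n j \<ge> M" using n by (auto simp: tl_def)
          have "n(j := 0) \<in> slice j (n j) U" using n mem_slice_iff[of n U j] by (simp add: tl_def)
          then have "n(j := 0) \<in> slice j (n j - 1) U" using M[OF j(1)] M[OF j(3)] by simp
          then have "n(j := n j - 1) \<in> tl" using j by (simp add: slice_def tl_def)
          moreover have "n = ?f (n(j := n j - 1))" using j by auto
          ultimately show ?thesis by blast
        qed (use n in \<open>auto simp: lev_def tl_def\<close>)
      qed
    qed
    moreover have "?S (lev M \<union> ?f ` tl) = ?S (lev M) + ?S (?f ` tl)"
    proof (rule counting_series_Un)
      have "?f ` tl \<subseteq> U" using insert.prems(2) by (auto simp: tl_def up_closed_def)
      then show "finite {u \<in> ?f ` tl. weight w ?I u = n}" for n by (rule fin)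
      show "finite {u \<in> lev M. weight w ?I u = n}" for n by (rule fin) (auto simp: lev_def)
      show "lev M \<inter> ?f ` tl = {}" by (auto simp: lev_def tl_def)
    qed
    moreover have "?S (?f ` tl) = fps_X ^ w j * ?S tl"
    proof (rule counting_series_image)
      show "inj_on ?f tl"
      proof (rule inj_onI)
        fix n n' assume a: "n(j := Suc (n j)) = n'(j := Suc (n' j))"
        show "n = n'"
        proof
          fix x show "n x = n' x" using fun_cong[OF a, of x] by (cases "x = j") auto
        qed
      qed
      show "weight w ?I (?f n) = weight w ?I n + w j" for n
      proof -
        have "(\<Sum>i\<in>I. w i * (?f n) i) = weight w I n"
          using insert(2) by (intro sum.cong) auto
        then show ?thesis using insert(1,2) by simp
      qed
    qed
    ultimately show ?thesis by simp
  qed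
  ultimately have "?S U * (1 - fps_X ^ w j) = (1 - fps_X ^ w j) * (\<Sum>a<M. ?S (lev a)) + ?S (lev M)"
    by (simp add: algebra_simps)
  then have "?S U * (\<Prod>i\<in>?I. 1 - fps_X ^ w i) =
      ((1 - fps_X ^ w j) * (\<Sum>a<M. ?S (lev a)) + ?S (lev M)) * ?D"
    using insert(1,2) by (simp add: mult.assoc[symmetric])
  also have "\<dots> = (1 - fps_X ^ w j) * (\<Sum>a<M. ?S (lev a) * ?D) + ?S (lev M) * ?D"
    by (simp add: algebra_simps sum_distrib_left sum_distrib_right)
  also have "is_polynomial \<dots>"
  proof -
    have "is_polynomial (?S (lev a) * ?D)" for a
    proof -
      have "is_polynomial (counting_series (weight w I) (slice j a U) * ?D)"
        using insert.IH[OF _ up[of a]] insert.prems(1) by simp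
      then have "is_polynomial (fps_X ^ (w j * a) * (counting_series (weight w I) (slice j a U) * ?D))"
        by (rule is_polynomial_mult[OF is_polynomial_X_power])
      then show ?thesis unfolding lev by (simp only: mult.assoc)
    qed
    note P = this
    have "is_polynomial (\<Sum>a<M. ?S (lev a) * ?D)" by (rule is_polynomial_sum) (rule P)
    then show ?thesis
      by (rule is_polynomial_add[OF is_polynomial_mult[OF is_polynomial_diff[OF
            is_polynomial_1 is_polynomial_X_power]] P])
  qed
  finally show ?case .
qed

section \<open>Layers of a vector\<close>

definition layer :: "nat \<Rightarrow> ('b \<Rightarrow> nat) \<Rightarrow> 'b set" where
  "layer t d = {i. t \<le> d i}"

definition raise :: "'b set \<Rightarrow> ('b \<Rightarrow> nat) \<Rightarrow> 'b \<Rightarrow> nat" where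
  "raise S d = (\<lambda>i. if i \<in> S then Suc (d i) else d i)"

definition layers_above :: "nat \<Rightarrow> ('b \<Rightarrow> nat) \<Rightarrow> 'b set set" where
  "layers_above K d = {S. S \<noteq> {} \<and> (\<exists>t>K. layer t d = S)}"

definition layer_multiplicity :: "nat \<Rightarrow> ('b \<Rightarrow> nat) \<Rightarrow> 'b set \<Rightarrow> nat" where
  "layer_multiplicity K d S = (if S = {} then 0 else card {t. t > K \<and> layer t d = S})"

lemma layer_antimono: "s \<le> t \<Longrightarrow> layer t d \<subseteq> layer s d"
  by (auto simp: layer_def)

lemma finite_layer_levels: "S \<noteq> {} \<Longrightarrow> finite {t. t > K \<and> layer t d = S}"
proof -
  assume "S \<noteq> {}"
  then obtain i where "i \<in> S" by blast
  then have "{t. t > K \<and> layer t d = S} \<subseteq> {..d i}" by (auto simp: layer_def)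
  then show ?thesis by (rule finite_subset) simp
qed

lemma layer_multiplicity_eq_0: "S \<notin> layers_above K d \<Longrightarrow> layer_multiplicity K d S = 0"
proof (cases "S = {}")
  case False
  moreover assume "S \<notin> layers_above K d"
  ultimately have e: "{t. t > K \<and> layer t d = S} = {}" by (auto simp: layers_above_def)
  show ?thesis unfolding layer_multiplicity_def e by simp
qed (simp add: layer_multiplicity_def)

text \<open>Layers are nested, so two of the same finite size coincide.\<close>

lemma inj_on_card_layers_above:
  assumes "\<And>S. S \<in> layers_above K d \<Longrightarrow> finite S"
  shows "inj_on card (layers_above K d)"
proof (rule inj_onI)
  fix S T assume a: "S \<in> layers_above K d" "T \<in> layers_above K d" "card S = card T"
  then obtain s t where "S = layer s d" "T = layer t d" by (auto simp: layers_above_def)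
  then have "S \<subseteq> T \<or> T \<subseteq> S" using layer_antimono[of s t d] layer_antimono[of t s d] linear[of s t] by auto
  then show "S = T" using assms a card_subset_eq[of T S] card_subset_eq[of S T] by auto
qed

text \<open>The height of \<open>d\<close> above \<open>K\<close> at \<open>i\<close> is the number of levels \<open>t > K\<close> whose layer contains \<open>i\<close>.\<close>

lemma eq_min_plus_layers:
  assumes fin: "finite (layers_above K d)"
  shows "d i = min (d i) K + (\<Sum>S\<in>layers_above K d. if i \<in> S then layer_multiplicity K d S else 0)"
proof -
  let ?I = "{S \<in> layers_above K d. i \<in> S}"
  have "{K<..d i} = (\<Union>S\<in>?I. {t. t > K \<and> layer t d = S})"
    by (auto simp: layers_above_def layer_def)
  then have "card {K<..d i} = card (\<Union>S\<in>?I. {t. t > K \<and> layer t d = S})" by simp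
  also have "\<dots> = (\<Sum>S\<in>?I. card {t. t > K \<and> layer t d = S})"
    using fin by (intro card_UN_disjoint) (auto intro: finite_layer_levels)
  also have "\<dots> = (\<Sum>S\<in>?I. layer_multiplicity K d S)"
    by (intro sum.cong) (auto simp: layer_multiplicity_def)
  also have "\<dots> = (\<Sum>S\<in>layers_above K d. if i \<in> S then layer_multiplicity K d S else 0)"
    using fin by (simp add: sum.If_cases Int_def)
  finally show ?thesis by simp
qed

text \<open>Raising along the layer at level \<open>u\<close> repeats that layer once and moves all higher layers up by one
  level; hence the set of layers stays the same and exactly one multiplicity grows, by one.\<close>

lemma layer_raise:
  assumes "S = layer u d"
  shows "layer t (raise S d) = (if t \<le> u then layer t d else layer (t - 1) d)"
  using assms by (auto simp: layer_def raise_def)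

lemma layers_above_raise:
  assumes "S = layer u d" "u > K"
  shows "layers_above K (raise S d) = layers_above K d"
proof -
  have "(\<exists>t>K. layer t (raise S d) = T) \<longleftrightarrow> (\<exists>t>K. layer t d = T)" for T
  proof
    assume "\<exists>t>K. layer t (raise S d) = T"
    then obtain t where t: "t > K" "layer t (raise S d) = T" by blast
    then show "\<exists>t>K. layer t d = T"
      using assms(2) layer_raise[OF assms(1), of t]
      by (cases "t \<le> u") (auto intro: exI[of _ "t - 1"])
  next
    assume "\<exists>t>K. layer t d = T"
    then obtain t where t: "t > K" "layer t d = T" by blast
    then show "\<exists>t>K. layer t (raise S d) = T"
      using layer_raise[OF assms(1), of t] layer_raise[OF assms(1), of "Suc t"]
      by (cases "t \<le> u") (auto intro: exI[of _ "Suc t"])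
  qed
  then show ?thesis by (simp add: layers_above_def)
qed

lemma layer_multiplicity_raise:
  assumes S: "S = layer u d" "u > K" "S \<noteq> {}"
  shows "layer_multiplicity K (raise S d) =
    (layer_multiplicity K d)(S := Suc (layer_multiplicity K d S))"
proof
  fix T
  show "layer_multiplicity K (raise S d) T =
    ((layer_multiplicity K d)(S := Suc (layer_multiplicity K d S))) T"
  proof (cases "T = {}")
    case False
    \<comment> \<open>Levels up to \<open>u\<close> keep their layer, those from \<open>u\<close> on pass it to the next level; level \<open>u\<close> counts twice.\<close>
    let ?A = "{t. K < t \<and> t \<le> u \<and> layer t d = T}" and ?B = "{t. u \<le> t \<and> layer t d = T}"
    have fin: "finite ?A" "finite ?B"
      by (rule finite_subset[OF _ finite_layer_levels[OF False, of K d]]; use S(2) in auto)+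
    have "{t. t > K \<and> layer t (raise S d) = T} = ?A \<union> Suc ` ?B"
    proof (intro set_eqI iffI)
      fix t assume t: "t \<in> {t. t > K \<and> layer t (raise S d) = T}"
      show "t \<in> ?A \<union> Suc ` ?B"
      proof (cases "t \<le> u")
        case False
        then have "t = Suc (t - 1)" "t - 1 \<in> ?B" using t layer_raise[OF S(1), of t] by auto
        then show ?thesis by blast
      qed (use t layer_raise[OF S(1), of t] in auto)
    next
      fix t assume "t \<in> ?A \<union> Suc ` ?B"
      then show "t \<in> {t. t > K \<and> layer t (raise S d) = T}"
        using layer_raise[OF S(1)] S(2) by auto
    qed
    moreover have "?A \<inter> Suc ` ?B = {}" by auto
    ultimately have 1: "card {t. t > K \<and> layer t (raise S d) = T} = card ?A + card ?B"
      using fin by (simp add: card_Un_disjoint card_image)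
    have "{t. t > K \<and> layer t d = T} = ?A \<union> ?B" using S(2) by auto
    then have 2: "card {t. t > K \<and> layer t d = T} + card (?A \<inter> ?B) = card ?A + card ?B"
      using card_Un_Int[OF fin] by simp
    have "?A \<inter> ?B = {t. t = u \<and> layer u d = T}" using S(2) by auto
    then have 3: "?A \<inter> ?B = {t. t = u \<and> S = T}" unfolding S(1) .
    have "card (?A \<inter> ?B) = (if S = T then 1 else 0)" unfolding 3 by simp
    then have "card {t. t > K \<and> layer t (raise S d) = T} =
        card {t. t > K \<and> layer t d = T} + (if S = T then 1 else 0)"
      using 1 2 by presburger
    then show ?thesis using False by (simp add: layer_multiplicity_def)
  qed (use S in \<open>auto simp: layer_multiplicity_def\<close>)
qed

text \<open>The vectors are sorted by their truncation at \<open>K\<close> and their chain of layers above \<open>K\<close>, of which there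
  are finitely many. Within one such fibre a vector is determined by the multiplicities of its layers,
  and by closure under \<open>raise\<close> these multiplicities form an up-closed set.\<close>

lemma counting_series_layered:
  fixes L :: "(nat \<Rightarrow> nat) set"
  assumes supp: "\<And>d i. d \<in> L \<Longrightarrow> i \<ge> m \<Longrightarrow> d i = 0"
    and J: "J \<subseteq> {..<m}"
    and bound: "\<And>d i. d \<in> L \<Longrightarrow> i \<notin> J \<Longrightarrow> d i \<le> K"
    and closed: "\<And>d t. d \<in> L \<Longrightarrow> t > K \<Longrightarrow> layer t d \<noteq> {} \<Longrightarrow> raise (layer t d) d \<in> L"
  shows "is_polynomial (counting_series (\<lambda>d. \<Sum>i<m. d i) L * (\<Prod>i=1..card J. 1 - fps_X ^ i))"
proof -
  let ?deg = "\<lambda>d::nat \<Rightarrow> nat. \<Sum>i<m. d i"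
  define sig where "sig d = (\<lambda>i. min (d i) K, layers_above K d)" for d :: "nat \<Rightarrow> nat"
  define fib where "fib s = {d \<in> L. sig d = s}" for s
  have finJ: "finite J" using J finite_subset by blast
  have top: "S \<subseteq> J" if "d \<in> L" "S \<in> layers_above K d" for d S
    using that bound by (fastforce simp: layers_above_def layer_def)
  then have fintop: "finite (layers_above K d)" if "d \<in> L" for d
    using that finJ by (meson Pow_iff finite_Pow_iff finite_subset subsetI)
  have degree: "?deg d = (\<Sum>i<m. min (d i) K) + weight card (layers_above K d) (layer_multiplicity K d)"
    if d: "d \<in> L" for d
  proof -
    have "?deg d = (\<Sum>i<m. min (d i) K + (\<Sum>S\<in>layers_above K d. if i \<in> S then layer_multiplicity K d S else 0))"
      by (intro sum.cong refl eq_min_plus_layers fintop d)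
    also have "\<dots> = (\<Sum>i<m. min (d i) K) +
        (\<Sum>S\<in>layers_above K d. \<Sum>i<m. if i \<in> S then layer_multiplicity K d S else 0)"
      unfolding sum.distrib by (subst sum.swap) simp
    also have "(\<Sum>S\<in>layers_above K d. \<Sum>i<m. if i \<in> S then layer_multiplicity K d S else 0) =
        weight card (layers_above K d) (layer_multiplicity K d)"
    proof (rule sum.cong)
      fix S assume "S \<in> layers_above K d"
      then have "{..<m} \<inter> S = S" using top[OF d] J by blast
      then show "(\<Sum>i<m. if i \<in> S then layer_multiplicity K d S else 0) = card S * layer_multiplicity K d S"
        by (simp flip: sum.inter_restrict)
    qed simp
    finally show ?thesis .
  qed
  have finfib: "finite {d \<in> fib s. ?deg d = n}" for s n
  proof (rule finite_subset)
    show "{d \<in> fib s. ?deg d = n} \<subseteq> {d. \<forall>i. (i \<in> {..<m} \<longrightarrow> d i \<in> {..n}) \<and> (i \<notin> {..<m} \<longrightarrow> d i = 0)}"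
    proof (intro subsetI CollectI allI conjI impI)
      fix d i assume d: "d \<in> {d \<in> fib s. ?deg d = n}"
      show "d i = 0" if "i \<notin> {..<m}" using d that supp by (auto simp: fib_def)
      show "d i \<in> {..n}" if "i \<in> {..<m}"
        using d that member_le_sum[of i "{..<m}" d] by auto
    qed
    show "finite {d. \<forall>i. (i \<in> {..<m} \<longrightarrow> d i \<in> {..n}) \<and> (i \<notin> {..<m} \<longrightarrow> d i = (0::nat))}"
      by (intro finite_set_of_finite_funs) auto
  qed
  have fibre: "is_polynomial (counting_series ?deg (fib s) * (\<Prod>i=1..card J. 1 - fps_X ^ i))"
    if s: "s \<in> sig ` L" for s
  proof -
    let ?I = "snd s"
    let ?U = "layer_multiplicity K ` fib s"
    obtain d0 where d0: "d0 \<in> L" "s = sig d0" using s by blast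
    then have I: "finite ?I" "\<And>S. S \<in> ?I \<Longrightarrow> S \<subseteq> J \<and> S \<noteq> {}" "inj_on card ?I"
    proof -
      show "finite ?I" using d0 fintop by (simp add: sig_def)
      show I2: "S \<subseteq> J \<and> S \<noteq> {}" if "S \<in> ?I" for S
        using d0 that top[of d0 S] by (auto simp: sig_def layers_above_def)
      show "inj_on card ?I"
        using d0 I2 finJ by (auto simp: sig_def intro!: inj_on_card_layers_above intro: finite_subset)
    qed
    have inj: "inj_on (layer_multiplicity K) (fib s)"
    proof (rule inj_onI)
      fix d d' assume d: "d \<in> fib s" "d' \<in> fib s" "layer_multiplicity K d = layer_multiplicity K d'"
      then have "sig d = sig d'" by (simp add: fib_def)
      then have e: "layers_above K d = layers_above K d'" "\<And>i. min (d i) K = min (d' i) K"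
        unfolding sig_def prod.inject by (simp, metis)
      show "d = d'"
      proof
        fix i
        have fin: "finite (layers_above K d)" "finite (layers_above K d')"
          using d fintop by (auto simp: fib_def)
        have "d i = min (d i) K + (\<Sum>S\<in>layers_above K d. if i \<in> S then layer_multiplicity K d S else 0)"
          by (rule eq_min_plus_layers[OF fin(1)])
        also have "\<dots> = min (d' i) K +
            (\<Sum>S\<in>layers_above K d'. if i \<in> S then layer_multiplicity K d' S else 0)"
          by (simp only: e d(3))
        also have "\<dots> = d' i" by (rule eq_min_plus_layers[OF fin(2), symmetric])
        finally show "d i = d' i" .
      qed
    qed
    have up: "up_closed ?I ?U"
      unfolding up_closed_def
    proof (intro ballI conjI allI impI)
      fix n S assume "n \<in> ?U"
      then obtain d where d: "d \<in> fib s" "n = layer_multiplicity K d" by blast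
      then have dI: "layers_above K d = ?I" "d \<in> L" by (auto simp: fib_def sig_def)
      show "n S = 0" if "S \<notin> ?I" using that d dI by (simp add: layer_multiplicity_eq_0)
      show "n(S := Suc (n S)) \<in> ?U" if "S \<in> ?I"
      proof -
        have "S \<noteq> {}" "\<exists>u>K. layer u d = S" using that dI by (auto simp: layers_above_def)
        then obtain u where u: "S \<noteq> {}" "u > K" "S = layer u d" by blast
        have "sig (raise S d) = sig d"
          using layers_above_raise[OF u(3,2)] u by (auto simp: sig_def raise_def layer_def)
        then have "raise S d \<in> fib s" using closed[of d u] u d dI by (simp add: fib_def)
        moreover have "layer_multiplicity K (raise S d) = n(S := Suc (n S))"
          using layer_multiplicity_raise[OF u(3,2,1)] d by simp
        ultimately show ?thesis by (metis image_eqI)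
      qed
    qed
    let ?f = "inv_into (fib s) (layer_multiplicity K)"
    have "counting_series ?deg (?f ` ?U) =
        fps_X ^ (\<Sum>i<m. fst s i) * counting_series (weight card ?I) ?U"
    proof (rule counting_series_image)
      show "inj_on ?f ?U" by (rule inj_on_inv_into) simp
      fix n assume "n \<in> ?U"
      then obtain d where d: "d \<in> fib s" "n = layer_multiplicity K d" by blast
      then have "?f n = d" using inj by simp
      then show "?deg (?f n) = weight card ?I n + (\<Sum>i<m. fst s i)"
        using degree[of d] d by (auto simp: fib_def sig_def)
    qed
    moreover have "?f ` ?U = fib s" using inj by (simp add: image_image)
    ultimately have eq: "counting_series ?deg (fib s) =
        fps_X ^ (\<Sum>i<m. fst s i) * counting_series (weight card ?I) ?U" by simp
    have sub: "card ` ?I \<subseteq> {1..card J}"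
    proof
      fix c assume "c \<in> card ` ?I"
      then obtain S where S: "S \<in> ?I" "c = card S" by blast
      then show "c \<in> {1..card J}" using I(2)[OF S(1)] finJ card_mono[of J S]
        by (auto simp: Suc_le_eq card_gt_0_iff intro: finite_subset)
    qed
    have "(\<Prod>i=1..card J. 1 - fps_X ^ i) =
        (\<Prod>i\<in>{1..card J} - card ` ?I. 1 - fps_X ^ i) * (\<Prod>i\<in>card ` ?I. 1 - fps_X ^ i :: int fps)"
      by (rule prod.subset_diff[OF sub]) simp
    also have "(\<Prod>i\<in>card ` ?I. 1 - fps_X ^ i :: int fps) = (\<Prod>S\<in>?I. 1 - fps_X ^ card S)"
      by (simp add: prod.reindex[OF I(3)])
    finally have E: "counting_series ?deg (fib s) * (\<Prod>i=1..card J. 1 - fps_X ^ i) =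
      (fps_X ^ (\<Sum>i<m. fst s i) * (\<Prod>i\<in>{1..card J} - card ` ?I. 1 - fps_X ^ i)) *
      (counting_series (weight card ?I) ?U * (\<Prod>S\<in>?I. 1 - fps_X ^ card S))"
      by (simp only: eq mult_ac)
    have P: "is_polynomial (counting_series (weight card ?I) ?U * (\<Prod>S\<in>?I. 1 - fps_X ^ card S))"
    proof (rule counting_series_up_closed[OF I(1) _ up])
      fix S assume "S \<in> ?I"
      then show "card S > 0" using I(2) finJ by (auto simp: card_gt_0_iff intro: finite_subset)
    qed
    have "is_polynomial (fps_X ^ (\<Sum>i<m. fst s i) *
        (\<Prod>i\<in>{1..card J} - card ` ?I. 1 - fps_X ^ i :: int fps))"
      by (intro is_polynomial_mult is_polynomial_prod is_polynomial_diff is_polynomial_intros)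
    then show ?thesis unfolding E by (rule is_polynomial_mult[OF _ P])
  qed
  have "finite (sig ` L)"
  proof (rule finite_subset)
    show "sig ` L \<subseteq> {b. \<forall>i. (i \<in> {..<m} \<longrightarrow> b i \<in> {..K}) \<and> (i \<notin> {..<m} \<longrightarrow> b i = 0)} \<times> Pow (Pow J)"
    proof
      fix s assume "s \<in> sig ` L"
      then obtain d where d: "d \<in> L" "s = sig d" by blast
      then show "s \<in> {b. \<forall>i. (i \<in> {..<m} \<longrightarrow> b i \<in> {..K}) \<and> (i \<notin> {..<m} \<longrightarrow> b i = 0)} \<times> Pow (Pow J)"
        using supp[OF d(1)] top[OF d(1)] by (simp add: sig_def subset_iff)
    qed
    show "finite ({b. \<forall>i. (i \<in> {..<m} \<longrightarrow> b i \<in> {..K}) \<and> (i \<notin> {..<m} \<longrightarrow> b i = (0::nat))} \<times> Pow (Pow J))"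
      using finJ by (intro finite_cartesian_product finite_set_of_finite_funs) auto
  qed
  then have "counting_series ?deg (\<Union>s\<in>sig ` L. fib s) = (\<Sum>s\<in>sig ` L. counting_series ?deg (fib s))"
    by (rule counting_series_UN[OF _ finfib]) (auto simp: disjoint_family_on_def fib_def)
  moreover have "(\<Union>s\<in>sig ` L. fib s) = L" by (auto simp: fib_def)
  ultimately have "counting_series ?deg L = (\<Sum>s\<in>sig ` L. counting_series ?deg (fib s))" by simp
  then have E: "counting_series ?deg L * (\<Prod>i=1..card J. 1 - fps_X ^ i) =
     (\<Sum>s\<in>sig ` L. counting_series ?deg (fib s) * (\<Prod>i=1..card J. 1 - fps_X ^ i))"
    by (simp add: sum_distrib_right)
  show ?thesis unfolding E by (rule is_polynomial_sum) (rule fibre)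
qed

section \<open>Growth of rational series\<close>

text \<open>For \<open>l > 0\<close>, the expansion of \<open>1 / ((1 - X) * (1 - X ^ l) ^ m)\<close>: multiplying by \<open>1 - X ^ l\<close> takes differences
  at distance \<open>l\<close>, which lowers \<open>m\<close> by one through Pascal's rule.\<close>

definition divided_binomials :: "nat \<Rightarrow> nat \<Rightarrow> int fps" where
  "divided_binomials l m = Abs_fps (\<lambda>n. int ((n div l + m) choose m))"

lemma divided_binomials_Suc:
  assumes "l > 0"
  shows "divided_binomials l (Suc m) * (1 - fps_X ^ l) = divided_binomials l m"
proof (rule fps_ext)
  fix n
  have "(divided_binomials l (Suc m) * (1 - fps_X ^ l)) $ n = int ((n div l + Suc m) choose Suc m) -
      (if n < l then 0 else int (((n - l) div l + Suc m) choose Suc m))"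
    by (simp add: divided_binomials_def right_diff_distrib fps_X_power_mult_right_nth)
  also have "\<dots> = int ((n div l + m) choose m)"
  proof (cases "n < l")
    case False
    then have "n div l = Suc ((n - l) div l)" using assms by (simp add: le_div_geq)
    then show ?thesis using False by simp
  qed simp
  finally show "(divided_binomials l (Suc m) * (1 - fps_X ^ l)) $ n = divided_binomials l m $ n"
    by (simp add: divided_binomials_def)
qed

lemma divided_binomials_inverse:
  assumes "l > 0"
  shows "divided_binomials l m * ((1 - fps_X) * (1 - fps_X ^ l) ^ m) = 1"
proof (induction m)
  case 0
  have "divided_binomials l 0 * (1 - fps_X) = 1"
    by (rule fps_ext) (auto simp: divided_binomials_def right_diff_distrib)
  then show ?case by simp
next
  case (Suc m)
  have "divided_binomials l (Suc m) * ((1 - fps_X) * (1 - fps_X ^ l) ^ Suc m) =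
      (divided_binomials l (Suc m) * (1 - fps_X ^ l)) * ((1 - fps_X) * (1 - fps_X ^ l) ^ m)"
    by (simp add: algebra_simps)
  then show ?case using Suc divided_binomials_Suc[OF assms] by simp
qed

text \<open>The cofactor \<open>(1 - X ^ (d * c)) / (1 - X ^ d)\<close>.\<close>

definition geometric_poly :: "nat \<Rightarrow> nat \<Rightarrow> int poly" where
  "geometric_poly d c = (\<Sum>j<c. monom 1 (d * j))"

lemma geometric_poly_mult:
  "fps_of_poly (geometric_poly d c) * (1 - fps_X ^ d) = 1 - fps_X ^ (d * c)"
proof (induction c)
  case (Suc c)
  have "geometric_poly d (Suc c) = geometric_poly d c + monom 1 (d * c)"
    by (simp add: geometric_poly_def)
  then have "fps_of_poly (geometric_poly d (Suc c)) * (1 - fps_X ^ d) =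
      fps_of_poly (geometric_poly d c) * (1 - fps_X ^ d) + fps_X ^ (d * c) * (1 - fps_X ^ d)"
    by (simp only: fps_of_poly_add fps_of_poly_monom' distrib_right)
  also have "\<dots> = 1 - fps_X ^ (d * Suc c)"
    unfolding Suc by (simp add: power_add algebra_simps)
  finally show ?case .
qed (simp add: geometric_poly_def)

lemma poly_geometric_poly_1: "poly (geometric_poly d c) 1 = int c"
  by (simp add: geometric_poly_def poly_sum poly_monom)

text \<open>The factors \<open>1 - X ^ i\<close> with \<open>i \<ge> 2\<close> are completed to \<open>1 - X ^ (m + 1)!\<close> by cofactors whose value at
  \<open>1\<close> is positive, while the factor \<open>1 - X\<close> is left alone.\<close>

lemma series_eq_poly_times_divided_binomials:
  fixes H :: "int fps"
  assumes H: "H * (\<Prod>i=1..Suc m. 1 - fps_X ^ i) = fps_of_poly P"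
  obtains G where "H = fps_of_poly G * divided_binomials (fact (Suc m)) m"
    "poly G 1 = 0 \<longleftrightarrow> poly P 1 = 0"
proof
  let ?l = "fact (Suc m) :: nat"
  define Q where "Q = (\<Prod>i=2..Suc m. geometric_poly i (?l div i))"
  have Q1: "poly Q 1 \<noteq> 0"
  proof -
    have "?l div i \<noteq> 0" if "i \<in> {2..Suc m}" for i
    proof -
      have "i * (?l div i) = ?l" using that by (intro dvd_mult_div_cancel dvd_fact) auto
      then show ?thesis by (metis fact_nonzero mult_0_right)
    qed
    then show ?thesis by (simp add: Q_def poly_prod poly_geometric_poly_1 del: fact_Suc)
  qed
  have "(\<Prod>i=1..Suc m. 1 - fps_X ^ i :: int fps) = (1 - fps_X) * (\<Prod>i=2..Suc m. 1 - fps_X ^ i)"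
    by (subst prod.atLeast_Suc_atMost) (simp_all add: numeral_2_eq_2)
  note split = this
  have "(\<Prod>i=1..Suc m. 1 - fps_X ^ i) * fps_of_poly Q =
      (1 - fps_X) * (\<Prod>i=2..Suc m. fps_of_poly (geometric_poly i (?l div i)) * (1 - fps_X ^ i))"
    unfolding split Q_def fps_of_poly_prod prod.distrib by (simp only: mult_ac)
  also have "(\<Prod>i=2..Suc m. fps_of_poly (geometric_poly i (?l div i)) * (1 - fps_X ^ i)) =
      (\<Prod>i=2..Suc m. 1 - fps_X ^ ?l)"
  proof (rule prod.cong)
    fix i assume "i \<in> {2..Suc m}"
    then have "i * (?l div i) = ?l" by (intro dvd_mult_div_cancel dvd_fact) auto
    then show "fps_of_poly (geometric_poly i (?l div i)) * (1 - fps_X ^ i) = 1 - fps_X ^ ?l"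
      by (simp only: geometric_poly_mult)
  qed simp
  also have "\<dots> = (1 - fps_X ^ ?l) ^ m" by (simp del: fact_Suc)
  finally have D: "(\<Prod>i=1..Suc m. 1 - fps_X ^ i) * fps_of_poly Q = (1 - fps_X) * (1 - fps_X ^ ?l) ^ m" .
  have inv: "divided_binomials ?l m * ((1 - fps_X) * (1 - fps_X ^ ?l) ^ m) = 1"
    by (rule divided_binomials_inverse) simp
  have "H = H * (divided_binomials ?l m * ((1 - fps_X) * (1 - fps_X ^ ?l) ^ m))"
    by (simp only: inv mult_1_right)
  also have "\<dots> = (H * (\<Prod>i=1..Suc m. 1 - fps_X ^ i)) * fps_of_poly Q * divided_binomials ?l m"
    by (simp only: D[symmetric] mult_ac)
  also have "\<dots> = fps_of_poly (P * Q) * divided_binomials ?l m"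
    by (simp only: H fps_of_poly_mult)
  finally show "H = fps_of_poly (P * Q) * divided_binomials ?l m" .
  show "poly (P * Q) 1 = 0 \<longleftrightarrow> poly P 1 = 0" using Q1 by simp
qed

lemma binomial_eq_prod:
  "real ((q + m) choose m) = (\<Prod>j=1..m. real q + real j) / fact m"
proof (induction m)
  case (Suc m)
  have "Suc m * ((q + Suc m) choose Suc m) = Suc (q + m) * ((q + m) choose m)"
    using Suc_times_binomial[of m "q + m"] by simp
  then have "real (Suc m) * real ((q + Suc m) choose Suc m) = real (Suc (q + m)) * real ((q + m) choose m)"
    by (metis of_nat_mult)
  then have "real ((q + Suc m) choose Suc m) = real (Suc (q + m)) * real ((q + m) choose m) / real (Suc m)"
    by (metis nonzero_mult_div_cancel_left of_nat_neq_0)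
  moreover have "(\<Prod>j=1..Suc m. real q + real j) = (\<Prod>j=1..m. real q + real j) * real (Suc (q + m))"
    by simp
  moreover have "fact (Suc m) = real (Suc m) * fact m" by simp
  ultimately show ?case
    by (simp only: Suc times_divide_eq_right divide_divide_eq_left mult_ac)
qed simp

lemma coeff_prod_linear:
  fixes e :: real
  assumes "finite A"
  shows "degree (\<Prod>j\<in>A. [:c j, e:]) \<le> card A \<and> coeff (\<Prod>j\<in>A. [:c j, e:]) (card A) = e ^ card A"
  using assms
proof (induction A rule: finite_induct)
  case (insert x A)
  let ?p = "\<Prod>j\<in>A. [:c j, e:]"
  have "degree ([:c x, e:] * ?p) \<le> degree [:c x, e:] + degree ?p" by (rule degree_mult_le)
  also have "\<dots> \<le> 1 + card A" using insert.IH by (intro add_mono) auto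
  finally have "degree ([:c x, e:] * ?p) \<le> Suc (card A)" by simp
  moreover have "coeff ?p (Suc (card A)) = 0" using insert.IH by (intro coeff_eq_0) simp
  then have "coeff ([:c x, e:] * ?p) (Suc (card A)) = e ^ Suc (card A)"
    using insert.IH by simp
  ultimately show ?case using insert.hyps by simp
qed simp

lemma poly_eq_sum_upto:
  fixes p :: "real poly"
  assumes "degree p \<le> m"
  shows "poly p x = (\<Sum>j\<le>m. coeff p j * x ^ j)"
  unfolding poly_altdef using assms by (intro sum.mono_neutral_left) (auto intro: coeff_eq_0)

lemma poly_over_power_tendsto:
  fixes p :: "real poly"
  assumes "degree p \<le> m"
  shows "(\<lambda>n. poly p (real n) / real n ^ m) \<longlonglongrightarrow> coeff p m"
proof -
  have "(\<lambda>n. \<Sum>j\<le>m. coeff p j * inverse (real n) ^ (m - j)) \<longlonglongrightarrow> (\<Sum>j\<le>m. coeff p j * 0 ^ (m - j))"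
    by (intro tendsto_intros lim_inverse_n)
  also have "(\<Sum>j\<le>m. coeff p j * 0 ^ (m - j)) = (\<Sum>j\<le>m. if j = m then coeff p j else 0)"
    by (intro sum.cong) auto
  also have "\<dots> = coeff p m" by simp
  finally have "(\<lambda>n. \<Sum>j\<le>m. coeff p j * inverse (real n) ^ (m - j)) \<longlonglongrightarrow> coeff p m" .
  moreover have "\<forall>\<^sub>F n in sequentially.
      (\<Sum>j\<le>m. coeff p j * inverse (real n) ^ (m - j)) = poly p (real n) / real n ^ m"
    using eventually_gt_at_top[of 0]
  proof eventually_elim
    case (elim n)
    have "inverse (real n) ^ (m - j) = real n ^ j / real n ^ m" if "j \<le> m" for j
      using elim that by (simp add: power_diff inverse_eq_divide power_divide)
    then show ?case
      by (simp add: poly_eq_sum_upto[OF assms] sum_divide_distrib)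
  qed
  ultimately show ?thesis by (rule Lim_transform_eventually)
qed

text \<open>As \<open>(n - i) div l\<close> is \<open>(n - i - s) / l\<close> with a remainder \<open>s\<close> that depends only on \<open>i\<close> and \<open>n mod l\<close>, each
  binomial coefficient is a polynomial in \<open>n\<close> on every residue class. The leading coefficient
  does not see the remainders.\<close>

lemma divided_binomials_quasi_polynomial:
  assumes "l > 0"
  obtains q :: "nat \<Rightarrow> real poly" where
    "\<And>r. degree (q r) \<le> m"
    "\<And>r. coeff (q r) m = real_of_int (poly G 1) / (fact m * real l ^ m)"
    "\<And>n. n \<ge> degree G \<Longrightarrow>
      real_of_int ((fps_of_poly G * divided_binomials l m) $ n) = poly (q (n mod l)) (real n)"
proof
  let ?D = "degree G"
  \<comment> \<open>Adding \<open>l * ?D\<close>, which is at least \<open>i\<close>, avoids truncated subtraction in \<open>(n - i) mod l\<close>.\<close>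
  define s where "s r i = (r + (l * ?D - i)) mod l" for r i
  define b where "b r i = (\<Prod>j=1..m. [:real j - (real i + real (s r i)) / l, 1 / l:])" for r i
  define q where "q r = (\<Sum>i\<le>?D. smult (real_of_int (coeff G i) / fact m) (b r i))" for r
  have b: "degree (b r i) \<le> m" "coeff (b r i) m = (1 / l) ^ m" for r i
    using coeff_prod_linear[of "{1..m}" "\<lambda>j. real j - (real i + real (s r i)) / l" "1 / l"]
    by (simp_all add: b_def)
  show "degree (q r) \<le> m" for r
    unfolding q_def by (intro degree_sum_le) (auto intro: order.trans[OF degree_smult_le] b)
  show "coeff (q r) m = real_of_int (poly G 1) / (fact m * real l ^ m)" for r
    by (simp add: q_def coeff_sum b poly_altdef sum_divide_distrib power_one_over divide_simps)
  show "real_of_int ((fps_of_poly G * divided_binomials l m) $ n) = poly (q (n mod l)) (real n)"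
    if n: "n \<ge> ?D" for n
  proof -
    have "(fps_of_poly G * divided_binomials l m) $ n =
        (\<Sum>i=0..n. coeff G i * int (((n - i) div l + m) choose m))"
      by (simp add: fps_mult_nth divided_binomials_def)
    also have "\<dots> = (\<Sum>i\<le>?D. coeff G i * int (((n - i) div l + m) choose m))"
      using n by (intro sum.mono_neutral_right) (auto intro: coeff_eq_0)
    finally have "real_of_int ((fps_of_poly G * divided_binomials l m) $ n) =
        (\<Sum>i\<le>?D. real_of_int (coeff G i) * real (((n - i) div l + m) choose m))" by simp
    also have "\<dots> = (\<Sum>i\<le>?D. real_of_int (coeff G i) / fact m * poly (b (n mod l) i) (real n))"
    proof (rule sum.cong)
      fix i assume i: "i \<in> {..?D}"
      then have iD: "i \<le> l * ?D" using assms by (simp add: le_trans[OF _ mult_le_mono1[of 1 l]])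
      have "s (n mod l) i = (n + (l * ?D - i)) mod l" by (simp add: s_def mod_add_left_eq)
      also have "n + (l * ?D - i) = (n - i) + l * ?D" using i n iD by simp
      also have "((n - i) + l * ?D) mod l = (n - i) mod l" by simp
      finally have s: "s (n mod l) i = (n - i) mod l" .
      have "l * ((n - i) div l) + (n - i) mod l = n - i" by simp
      then have "real l * real ((n - i) div l) + real ((n - i) mod l) = real (n - i)"
        by (metis of_nat_add of_nat_mult)
      then have "real ((n - i) div l) = (real n - real i - real (s (n mod l) i)) / l"
        using i n assms by (simp add: s of_nat_diff field_simps)
      then have "poly [:real j - (real i + real (s (n mod l) i)) / l, 1 / l:] (real n) =
          real ((n - i) div l) + real j" for j
        by (simp add: add_divide_distrib diff_divide_distrib)
      then have "poly (b (n mod l) i) (real n) = (\<Prod>j=1..m. real ((n - i) div l) + real j)"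
        by (simp only: b_def poly_prod)
      then have "real (((n - i) div l + m) choose m) = poly (b (n mod l) i) (real n) / fact m"
        by (simp only: binomial_eq_prod)
      then show "real_of_int (coeff G i) * real (((n - i) div l + m) choose m) =
          real_of_int (coeff G i) / fact m * poly (b (n mod l) i) (real n)" by simp
    qed simp
    also have "\<dots> = poly (q (n mod l)) (real n)" by (simp add: q_def poly_sum)
    finally show ?thesis .
  qed
qed

text \<open>The coefficients divided by \<open>n ^ m\<close> tend to a positive multiple of \<open>P(1)\<close>, and the lower bound
  keeps this limit away from \<open>0\<close>.\<close>

lemma rational_series_growth:
  fixes h :: "nat \<Rightarrow> nat"
  assumes H: "Abs_fps (\<lambda>n. int (h n)) * (\<Prod>i=1..Suc m. 1 - fps_X ^ i) = fps_of_poly P"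
    and c: "c > 0" "\<forall>\<^sub>F n in sequentially. c * real n ^ m \<le> real (h n)"
  shows "poly P 1 \<noteq> 0" "eventually_quasi_polynomial m h"
    "\<exists>a>0. (\<lambda>n. real (h n)) \<sim>[at_top] (\<lambda>n. a * real n ^ m)"
proof -
  let ?l = "fact (Suc m) :: nat"
  obtain G where G: "Abs_fps (\<lambda>n. int (h n)) = fps_of_poly G * divided_binomials ?l m"
    "poly G 1 = 0 \<longleftrightarrow> poly P 1 = 0"
    using series_eq_poly_times_divided_binomials[OF H] by metis
  have l: "?l > 0" by (rule fact_gt_zero)
  define a where "a = real_of_int (poly G 1) / (fact m * real ?l ^ m)"
  obtain q :: "nat \<Rightarrow> real poly" where q: "\<And>r. degree (q r) \<le> m" "\<And>r. coeff (q r) m = a"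
    and qn: "\<And>n. n \<ge> degree G \<Longrightarrow>
      real_of_int ((fps_of_poly G * divided_binomials ?l m) $ n) = poly (q (n mod ?l)) (real n)"
    using divided_binomials_quasi_polynomial[OF l, of m G] unfolding a_def by metis
  have h: "real (h n) = poly (q (n mod ?l)) (real n)" if "n \<ge> degree G" for n
    using qn[OF that] unfolding G(1)[symmetric] by simp
  have lim: "(\<lambda>n. real (h n) / real n ^ m) \<longlonglongrightarrow> a"
  proof (rule tendstoI)
    fix e :: real assume "e > 0"
    then have "\<forall>r\<in>{..<?l}. \<forall>\<^sub>F n in sequentially. dist (poly (q r) (real n) / real n ^ m) a < e"
      using tendstoD[OF poly_over_power_tendsto[OF q(1)]] q(2) by simp
    then have "\<forall>\<^sub>F n in sequentially. \<forall>r\<in>{..<?l}. dist (poly (q r) (real n) / real n ^ m) a < e"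
      by (intro eventually_ball_finite) auto
    then show "\<forall>\<^sub>F n in sequentially. dist (real (h n) / real n ^ m) a < e"
      using eventually_ge_at_top[of "degree G"]
    proof eventually_elim
      case (elim n)
      have "n mod ?l \<in> {..<?l}" using l by simp
      then show ?case using elim h by simp
    qed
  qed
  have "c \<le> a"
  proof (rule tendsto_lowerbound[OF lim])
    show "\<forall>\<^sub>F n in sequentially. c \<le> real (h n) / real n ^ m"
      using c(2) eventually_gt_at_top[of 0] by eventually_elim (simp add: field_simps)
  qed simp
  then have a: "a > 0" using c(1) by simp
  then show "poly P 1 \<noteq> 0" using G(2) by (auto simp: a_def)
  have "quasi_polynomial m (\<lambda>n. poly (q (n mod ?l)) (real n))"
    unfolding quasi_polynomial_def
  proof (intro exI[of _ "\<lambda>j n. coeff (q (n mod ?l)) j"] conjI allI impI)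
    show "periodic (\<lambda>n. coeff (q (n mod ?l)) j)" for j
      unfolding periodic_def using l by (intro exI[of _ ?l]) (simp del: fact_Suc)
    show "\<exists>n. coeff (q (n mod ?l)) m \<noteq> 0" using a q(2) by simp
    show "poly (q (n mod ?l)) (real n) = (\<Sum>j\<le>m. coeff (q (n mod ?l)) j * real n ^ j)" for n
      by (rule poly_eq_sum_upto[OF q(1)])
  qed
  moreover have "\<forall>\<^sub>F n in sequentially. real (h n) = poly (q (n mod ?l)) (real n)"
    using eventually_ge_at_top[of "degree G"] by eventually_elim (rule h)
  ultimately show "eventually_quasi_polynomial m h"
    unfolding eventually_quasi_polynomial_def by blast
  have "(\<lambda>n. real (h n)) \<sim>[at_top] (\<lambda>n. a * real n ^ m)"
  proof (rule asymp_equivI')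
    have "(\<lambda>n. (real (h n) / real n ^ m) / a) \<longlonglongrightarrow> a / a"
      by (intro tendsto_divide lim tendsto_const) (use a in simp)
    then show "(\<lambda>n. real (h n) / (a * real n ^ m)) \<longlonglongrightarrow> 1"
      using a by (simp add: field_simps)
  qed
  with a show "\<exists>a>0. (\<lambda>n. real (h n)) \<sim>[at_top] (\<lambda>n. a * real n ^ m)" by blast
qed

lemma fps_of_int_mult:
  fixes F G :: "int fps"
  shows "Abs_fps (\<lambda>n. of_int ((F * G) $ n)) =
    Abs_fps (\<lambda>n. of_int (F $ n)) * Abs_fps (\<lambda>n. of_int (G $ n) :: 'a::comm_ring_1)"
  by (rule fps_ext) (simp add: fps_mult_nth)

text \<open>Passage from integer series, where the identity is a product, to the quotient of rational series.\<close>

lemma int_series_eq_divide: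
  fixes h :: "nat \<Rightarrow> nat"
  assumes H: "Abs_fps (\<lambda>n. int (h n)) * (\<Prod>i=1..k. 1 - fps_X ^ i) = fps_of_poly P"
  shows "Abs_fps (\<lambda>n. of_nat (h n) :: rat) = fps_of_poly (map_poly of_int P) / (\<Prod>i=1..k. 1 - fps_X ^ i)"
proof -
  let ?r = "\<lambda>F :: int fps. Abs_fps (\<lambda>n. rat_of_int (F $ n))"
  have "?r (\<Prod>i=1..k. 1 - fps_X ^ i) = (\<Prod>i=1..k. 1 - fps_X ^ i)"
  proof (induction k)
    case (Suc k)
    have "?r (1 - fps_X ^ Suc k) = 1 - fps_X ^ Suc k"
      by (rule fps_ext) (simp add: fps_X_power_nth)
    then show ?case using Suc by (simp add: fps_of_int_mult)
  qed (simp add: fps_eq_iff)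
  moreover have "?r (fps_of_poly P) = fps_of_poly (map_poly of_int P)"
    by (rule fps_ext) (simp add: coeff_map_poly)
  moreover have "?r (Abs_fps (\<lambda>n. int (h n))) = Abs_fps (\<lambda>n. of_nat (h n))" by simp
  ultimately have eq: "Abs_fps (\<lambda>n. of_nat (h n) :: rat) * (\<Prod>i=1..k. 1 - fps_X ^ i) =
      fps_of_poly (map_poly of_int P)"
    using arg_cong[OF H, of ?r] by (simp only: fps_of_int_mult)
  have "(\<Prod>i=1..k. 1 - fps_X ^ i :: rat fps) $ 0 = 1"
    by (induction k) simp_all
  then have "(\<Prod>i=1..k. 1 - fps_X ^ i :: rat fps) \<noteq> 0" by (metis fps_zero_nth zero_neq_one)
  then show ?thesis unfolding eq[symmetric] by simp
qed

section \<open>The minimal monomorphic decomposition\<close>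

abbreviation iso_on :: "('a, 'i) structure_data \<Rightarrow> 'a set \<Rightarrow> 'a set \<Rightarrow> bool" where
  "iso_on R A B \<equiv> isomorphic (restriction R A) (restriction R B)"

text \<open>All that is used of an isomorphism of restrictions is that it induces isomorphisms on all subsets. It
  allows the relations themselves to be forgotten.\<close>

definition hereditary_iso :: "('a, 'i) structure_data \<Rightarrow> ('a \<Rightarrow> 'a) \<Rightarrow> 'a set \<Rightarrow> 'a set \<Rightarrow> bool" where
  "hereditary_iso R f A B \<longleftrightarrow> bij_betw f A B \<and> (\<forall>C\<subseteq>A. iso_on R C (f ` C))"

lemma hereditary_isoD:
  assumes "hereditary_iso R f A B"
  shows "bij_betw f A B" "C \<subseteq> A \<Longrightarrow> iso_on R C (f ` C)"
  using assms by (simp_all add: hereditary_iso_def)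

lemma monomorphic_decompositionD:
  assumes "monomorphic_decomposition R D"
  shows "partition_on (base R) D"
    "A \<subseteq> base R \<Longrightarrow> finite A \<Longrightarrow> A' \<subseteq> base R \<Longrightarrow> finite A' \<Longrightarrow>
      (\<And>B. B \<in> D \<Longrightarrow> card (A \<inter> B) = card (A' \<inter> B)) \<Longrightarrow> iso_on R A A'"
  using assms unfolding monomorphic_decomposition_def by blast+

lemma iso_on_hereditary:
  assumes "iso_on R A B"
  obtains f where "hereditary_iso R f A B"
proof -
  from assms obtain f where f: "bij_betw f A B"
    and fr: "\<And>i xs. i \<in> index_set R \<Longrightarrow> xs \<in> tuples (arity R i) A \<Longrightarrow>
      xs \<in> tuples (arity R i) A \<inter> rel R i \<longleftrightarrow> map f xs \<in> tuples (arity R i) B \<inter> rel R i"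
    unfolding isomorphic_def restriction_def by auto
  have "iso_on R C (f ` C)" if C: "C \<subseteq> A" for C
  proof -
    have "bij_betw f C (f ` C)" using f C by (meson bij_betw_def inj_on_subset)
    moreover have "xs \<in> tuples (arity R i) C \<inter> rel R i \<longleftrightarrow> map f xs \<in> tuples (arity R i) (f ` C) \<inter> rel R i"
      if i: "i \<in> index_set R" and xs: "xs \<in> tuples (arity R i) C" for i xs
    proof -
      have "xs \<in> tuples (arity R i) A" using xs C by (auto simp: tuples_def)
      moreover from this have "map f xs \<in> tuples (arity R i) B"
        using f by (auto simp: tuples_def bij_betw_def)
      moreover have "map f xs \<in> tuples (arity R i) (f ` C)" using xs by (auto simp: tuples_def)
      ultimately show ?thesis using fr[OF i] xs by simp
    qed
    ultimately show ?thesis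
      unfolding isomorphic_def restriction_def by (intro conjI exI[of _ f]) simp_all
  qed
  then show ?thesis using that f unfolding hereditary_iso_def by blast
qed

lemma hereditary_iso_inv:
  assumes "hereditary_iso R f A B"
  shows "hereditary_iso R (inv_into A f) B A"
  unfolding hereditary_iso_def
proof (intro conjI allI impI)
  have f: "bij_betw f A B" using assms by (simp add: hereditary_iso_def)
  then show g: "bij_betw (inv_into A f) B A" by (rule bij_betw_inv_into)
  fix C assume C: "C \<subseteq> B"
  then have "inv_into A f ` C \<subseteq> A" using g by (auto simp: bij_betw_def)
  then have "iso_on R (inv_into A f ` C) (f ` (inv_into A f ` C))"
    using assms unfolding hereditary_iso_def by blast
  moreover have "f ` (inv_into A f ` C) = C" using f C by (simp add: image_inv_into_cancel bij_betw_def)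
  ultimately show "iso_on R C (inv_into A f ` C)" by (simp add: isomorphic_sym)
qed

lemma iso_on_card_eq:
  assumes "iso_on R A B"
  shows "card A = card B"
proof -
  obtain f where "hereditary_iso R f A B" using iso_on_hereditary[OF assms] .
  then show ?thesis by (rule bij_betw_same_card[OF hereditary_isoD(1)])
qed

text \<open>The relation is relative to a set \<open>U\<close>: over the base it defines the minimal decomposition, while over a
  finite set \<open>A\<close> it is an invariant of the restriction to \<open>A\<close>.\<close>

definition interchangeable :: "('a, 'i) structure_data \<Rightarrow> 'a set \<Rightarrow> 'a \<Rightarrow> 'a \<Rightarrow> bool" where
  "interchangeable R U x y \<longleftrightarrow>
     (\<forall>F. finite F \<and> F \<subseteq> U - {x, y} \<longrightarrow> iso_on R (insert x F) (insert y F))"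

lemma interchangeableD:
  "interchangeable R U x y \<Longrightarrow> finite F \<Longrightarrow> F \<subseteq> U - {x, y} \<Longrightarrow> iso_on R (insert x F) (insert y F)"
  by (simp add: interchangeable_def)

lemma interchangeable_refl: "interchangeable R U x x"
  by (simp add: interchangeable_def isomorphic_refl)

lemma interchangeable_sym: "interchangeable R U x y \<Longrightarrow> interchangeable R U y x"
  unfolding interchangeable_def by (metis insert_commute isomorphic_sym)

text \<open>If the middle element \<open>y\<close> lies in \<open>F\<close>, it cannot be inserted; then \<open>F = insert y G\<close>, and \<open>y\<close> is first
  exchanged for \<open>z\<close> next to \<open>x\<close>, and then \<open>x\<close> for \<open>y\<close> next to \<open>z\<close>.\<close>

lemma interchangeable_trans:
  assumes xy: "interchangeable R U x y" and yz: "interchangeable R U y z" and U: "x \<in> U" "z \<in> U"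
  shows "interchangeable R U x z"
proof (cases "x = y \<or> y = z \<or> x = z")
  case True
  then show ?thesis using xy yz interchangeable_refl by metis
next
  case False
  show ?thesis
    unfolding interchangeable_def
  proof (intro allI impI)
    fix F assume F: "finite F \<and> F \<subseteq> U - {x, z}"
    show "iso_on R (insert x F) (insert z F)"
    proof (cases "y \<in> F")
      case False
      then have "iso_on R (insert x F) (insert y F)" "iso_on R (insert y F) (insert z F)"
        using F by (auto intro!: interchangeableD[OF xy] interchangeableD[OF yz])
      then show ?thesis by (rule isomorphic_trans)
    next
      case y: True
      define G where "G = F - {y}"
      have G: "F = insert y G" "y \<notin> G" "finite G" "G \<subseteq> U - {x, y, z}"
        using y F by (auto simp: G_def)
      have "iso_on R (insert y (insert x G)) (insert z (insert x G))"
        using G U False by (intro interchangeableD[OF yz]) auto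
      moreover have "iso_on R (insert x (insert z G)) (insert y (insert z G))"
        using G U False by (intro interchangeableD[OF xy]) auto
      ultimately show ?thesis unfolding G(1) by (metis isomorphic_trans insert_commute)
    qed
  qed
qed

lemma interchangeable_transfer:
  assumes f: "hereditary_iso R f A B" and xy: "x \<in> A" "y \<in> A" "interchangeable R A x y"
  shows "interchangeable R B (f x) (f y)"
  unfolding interchangeable_def
proof (intro allI impI)
  fix F assume F: "finite F \<and> F \<subseteq> B - {f x, f y}"
  have bij: "bij_betw f A B" using f by (simp add: hereditary_iso_def)
  define G where "G = {a \<in> A. f a \<in> F}"
  have fG: "f ` G = F" using F bij by (auto simp: G_def bij_betw_def)
  have "inj_on f G" using bij by (auto simp: G_def bij_betw_def intro: inj_on_subset)
  then have "finite G" using fG F by (metis finite_imageD)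
  moreover have "G \<subseteq> A - {x, y}" using F by (auto simp: G_def)
  ultimately have 1: "iso_on R (insert x G) (insert y G)" by (rule interchangeableD[OF xy(3)])
  have her: "iso_on R (insert a G) (insert (f a) F)" if "a \<in> A" for a
  proof -
    have "insert a G \<subseteq> A" using that by (auto simp: G_def)
    then have "iso_on R (insert a G) (f ` insert a G)" by (rule hereditary_isoD(2)[OF f])
    then show ?thesis by (simp only: image_insert fG)
  qed
  show "iso_on R (insert (f x) F) (insert (f y) F)"
    using 1 her[OF xy(1)] her[OF xy(2)] by (meson isomorphic_sym isomorphic_trans)
qed

definition interchange_classes :: "('a, 'i) structure_data \<Rightarrow> 'a set set" where
  "interchange_classes R =
     base R // {(x, y). x \<in> base R \<and> y \<in> base R \<and> interchangeable R (base R) x y}"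

lemma equiv_interchangeable:
  "equiv (base R) {(x, y). x \<in> base R \<and> y \<in> base R \<and> interchangeable R (base R) x y}"
  by (intro equivI refl_onI symI transI)
     (auto intro: interchangeable_refl interchangeable_sym interchangeable_trans)

lemma partition_interchange_classes: "partition_on (base R) (interchange_classes R)"
  unfolding interchange_classes_def by (rule partition_on_quotient[OF equiv_interchangeable])

lemma interchange_classes_same:
  assumes "B \<in> interchange_classes R" "x \<in> B" "y \<in> B"
  shows "interchangeable R (base R) x y"
  using quotient_eq_iff[OF equiv_interchangeable] assms unfolding interchange_classes_def
  by fastforce

lemma interchange_classes_distinct:
  assumes "B \<in> interchange_classes R" "C \<in> interchange_classes R" "x \<in> B" "y \<in> C"
    "interchangeable R (base R) x y"
  shows "B = C"
proof -
  have "x \<in> base R" "y \<in> base R"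
    using partition_onD1[OF partition_interchange_classes, of R] assms by auto
  then show ?thesis
    using quotient_eq_iff[OF equiv_interchangeable] assms unfolding interchange_classes_def
    by fastforce
qed

lemma partition_on_unique_block:
  assumes "partition_on A P" "x \<in> B" "x \<in> C" "B \<in> P" "C \<in> P"
  shows "B = C"
  using assms disjointD[OF partition_onD2[OF assms(1)], of B C] by blast

text \<open>Two sets with the same counts are connected by exchanging points one at a time, each for a point of
  the same class.\<close>

lemma monomorphic_interchange_classes:
  "monomorphic_decomposition R (interchange_classes R)"
proof -
  let ?D = "interchange_classes R"
  note part = partition_interchange_classes[of R]
  have "iso_on R A A'"
    if "A \<subseteq> base R" "finite A" "A' \<subseteq> base R" "finite A'" "\<forall>B\<in>?D. card (A \<inter> B) = card (A' \<inter> B)"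
    for A A'
    using that
  proof (induction "card (A - A')" arbitrary: A rule: less_induct)
    case less
    show ?case
    proof (cases "A \<subseteq> A'")
      case True
      have "y \<in> A" if y: "y \<in> A'" for y
      proof -
        obtain B where B: "B \<in> ?D" "y \<in> B"
          using partition_onD1[OF part] y less.prems(3) by blast
        have "A \<inter> B = A' \<inter> B"
          using True B less.prems(4,5) by (intro card_subset_eq) auto
        then show ?thesis using y B by blast
      qed
      then have "A = A'" using True by blast
      then show ?thesis by (simp add: isomorphic_refl)
    next
      case False
      then obtain x where x: "x \<in> A" "x \<notin> A'" by blast
      obtain B where B: "B \<in> ?D" "x \<in> B"
        using partition_onD1[OF part] x less.prems(1) by blast
      have "\<exists>y. y \<in> A' \<inter> B \<and> y \<notin> A"
      proof (rule ccontr)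
        assume "\<nexists>y. y \<in> A' \<inter> B \<and> y \<notin> A"
        then have "A' \<inter> B = A \<inter> B"
          using B less.prems(2,5) by (intro card_subset_eq) auto
        then show False using x B by blast
      qed
      then obtain y where y: "y \<in> A'" "y \<in> B" "y \<notin> A" by blast
      define A1 where "A1 = insert y (A - {x})"
      have "interchangeable R (base R) x y" using interchange_classes_same B y by metis
      then have "iso_on R (insert x (A - {x})) (insert y (A - {x}))"
        by (rule interchangeableD) (use less.prems y in auto)
      then have 1: "iso_on R A A1" using x by (simp add: A1_def insert_absorb)
      have "iso_on R A1 A'"
      proof (rule less.hyps)
        have "A1 - A' = (A - A') - {x}" using y by (auto simp: A1_def)
        moreover have "x \<in> A - A'" using x by simp
        ultimately show "card (A1 - A') < card (A - A')"
          using less.prems(2) by (metis card_Diff1_less finite_Diff)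
        show "A1 \<subseteq> base R" "finite A1" using less.prems y by (auto simp: A1_def)
        show "\<forall>C\<in>?D. card (A1 \<inter> C) = card (A' \<inter> C)"
        proof
          fix C assume C: "C \<in> ?D"
          have "card (A1 \<inter> C) = card (A \<inter> C)"
          proof (cases "C = B")
            case True
            then have "A1 \<inter> C = insert y (A \<inter> B - {x})" using y by (auto simp: A1_def)
            then have "card (A1 \<inter> C) = Suc (card (A \<inter> B - {x}))" using y less.prems(2) by simp
            also have "\<dots> = card (A \<inter> B)" using x B less.prems(2) by (intro card.remove[symmetric]) auto
            finally show ?thesis using True by simp
          next
            case False
            then have "x \<notin> C" "y \<notin> C" using partition_on_unique_block[OF part] B C y by blast+
            then have "A1 \<inter> C = A \<inter> C" by (auto simp: A1_def)
            then show ?thesis by simp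
          qed
          then show "card (A1 \<inter> C) = card (A' \<inter> C)" using less.prems(5) C by simp
        qed
      qed (use less.prems in auto)
      with 1 show ?thesis by (rule isomorphic_trans)
    qed
  qed
  then show ?thesis using part unfolding monomorphic_decomposition_def by blast
qed

lemma same_block_interchangeable:
  assumes D: "monomorphic_decomposition R D" and B: "B \<in> D" "x \<in> B" "y \<in> B"
  shows "interchangeable R (base R) x y"
  unfolding interchangeable_def
proof (intro allI impI)
  fix F assume F: "finite F \<and> F \<subseteq> base R - {x, y}"
  have part: "partition_on (base R) D" using D by (simp add: monomorphic_decomposition_def)
  have xy: "x \<in> base R" "y \<in> base R" using partition_onD1[OF part] B by auto
  have "card (insert x F \<inter> C) = card (insert y F \<inter> C)" if C: "C \<in> D" for C
  proof (cases "C = B")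
    case True
    then have "insert x F \<inter> C = insert x (F \<inter> B)" "insert y F \<inter> C = insert y (F \<inter> B)"
      using B by auto
    moreover have "x \<notin> F \<inter> B" "y \<notin> F \<inter> B" "finite (F \<inter> B)" using F by auto
    ultimately show ?thesis by simp
  next
    case False
    then have "x \<notin> C" "y \<notin> C" using partition_on_unique_block[OF part] B C by blast+
    then show ?thesis by simp
  qed
  then show "iso_on R (insert x F) (insert y F)"
    by (intro monomorphic_decompositionD(2)[OF D]) (use F xy in auto)
qed

lemma refines_interchange_classes:
  assumes D: "monomorphic_decomposition R D"
  shows "refines (base R) D (interchange_classes R)"
  unfolding refines_def
proof (intro conjI ballI partition_interchange_classes)
  show part: "partition_on (base R) D" using D by (simp add: monomorphic_decomposition_def)
  fix B assume B: "B \<in> D"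
  then obtain x where x: "x \<in> B" using partition_onD3[OF part] by (metis ex_in_conv)
  have sub: "B \<subseteq> base R" using partition_onD1[OF part] B by auto
  then obtain C where C: "C \<in> interchange_classes R" "x \<in> C"
    using partition_onD1[OF partition_interchange_classes, of R] x by auto
  have "y \<in> C" if y: "y \<in> B" for y
  proof -
    obtain C' where C': "C' \<in> interchange_classes R" "y \<in> C'"
      using partition_onD1[OF partition_interchange_classes, of R] y sub by auto
    have "C = C'"
      by (rule interchange_classes_distinct[OF C(1) C'(1) C(2) C'(2)])
         (rule same_block_interchangeable[OF D B x y])
    then show ?thesis using C' by simp
  qed
  then show "\<exists>Y\<in>interchange_classes R. B \<subseteq> Y" using C by blast
qed

text \<open>Points in a common block of a monomorphic decomposition are interchangeable, so the classes form the
  coarsest such decomposition.\<close>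

lemma minimal_decomposition_eq: "minimal_monomorphic_decomposition R = interchange_classes R"
  unfolding minimal_monomorphic_decomposition_def
proof (rule the_equality)
  show "monomorphic_decomposition R (interchange_classes R) \<and>
    (\<forall>D'. monomorphic_decomposition R D' \<longrightarrow> refines (base R) D' (interchange_classes R))"
    using monomorphic_interchange_classes refines_interchange_classes by blast
  fix D assume D: "monomorphic_decomposition R D \<and>
    (\<forall>D'. monomorphic_decomposition R D' \<longrightarrow> refines (base R) D' D)"
  then show "D = interchange_classes R"
    using refines_asym[of "base R" D "interchange_classes R"] monomorphic_interchange_classes[of R]
      refines_interchange_classes[of R D] by simp
qed

lemma finite_interchange_classes:
  assumes "monomorphic_decomposition R D" "finite D"
  shows "finite (interchange_classes R)"
proof -
  have ref: "\<forall>B\<in>D. \<exists>C\<in>interchange_classes R. B \<subseteq> C"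
    using refines_interchange_classes[OF assms(1)] unfolding refines_def by simp
  then obtain f where f: "\<And>B. B \<in> D \<Longrightarrow> f B \<in> interchange_classes R \<and> B \<subseteq> f B" by metis
  note part = partition_interchange_classes[of R]
  have "interchange_classes R \<subseteq> f ` D"
  proof
    fix C assume C: "C \<in> interchange_classes R"
    then obtain x where x: "x \<in> C" using partition_onD3[OF part] by (metis ex_in_conv)
    then have "x \<in> base R" using partition_onD1[OF part] C by auto
    then obtain B where B: "B \<in> D" "x \<in> B"
      using partition_onD1[OF monomorphic_decompositionD(1)[OF assms(1)]] by blast
    then have "C = f B" using partition_on_unique_block[OF part x _ C, of "f B"] f by blast
    then show "C \<in> f ` D" using B by blast
  qed
  then show ?thesis using assms(2) by (meson finite_imageI finite_subset)
qed

section \<open>Leading shapes\<close>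

text \<open>The blocks are numbered, so that shapes are functions on \<open>nat\<close> that can be compared
  lexicographically. Numbers from \<open>m\<close> on stand for the empty set, on which every shape is \<open>0\<close>.\<close>

locale indexed_decomposition =
  fixes R :: "('a, 'i) structure_data" and E :: "nat \<Rightarrow> 'a set" and m :: nat
  assumes disjoint: "i \<noteq> j \<Longrightarrow> E i \<inter> E j = {}"
    and cover: "(\<Union>i. E i) = base R"
    and empty_iff: "E i = {} \<longleftrightarrow> m \<le> i"
    and monomorphic: "A \<subseteq> base R \<Longrightarrow> finite A \<Longrightarrow> A' \<subseteq> base R \<Longrightarrow> finite A' \<Longrightarrow>
      (\<And>i. card (A \<inter> E i) = card (A' \<inter> E i)) \<Longrightarrow> iso_on R A A'"
begin

definition shape :: "'a set \<Rightarrow> nat \<Rightarrow> nat" where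
  "shape A = (\<lambda>i. card (A \<inter> E i))"

lemma block_subset: "E i \<subseteq> base R"
  using cover by blast

lemma block_unique: "x \<in> E i \<Longrightarrow> x \<in> E j \<Longrightarrow> i = j"
  using disjoint by blast

lemma block_less: "x \<in> E i \<Longrightarrow> i < m"
  using empty_iff[of i] by (cases "i < m") auto

lemma obtain_block:
  assumes "x \<in> base R"
  obtains i where "x \<in> E i" "i < m"
  using assms cover block_less by blast

lemma same_shape_iso: "A \<subseteq> base R \<Longrightarrow> finite A \<Longrightarrow> A' \<subseteq> base R \<Longrightarrow> finite A' \<Longrightarrow>
      shape A = shape A' \<Longrightarrow> iso_on R A A'"
  by (rule monomorphic) (auto simp: shape_def dest: fun_cong)

lemma shape_eq_0: "m \<le> i \<Longrightarrow> shape A i = 0"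
  using empty_iff[of i] by (simp add: shape_def)

lemma shape_pos: "finite A \<Longrightarrow> x \<in> A \<Longrightarrow> x \<in> E i \<Longrightarrow> shape A i > 0"
  by (auto simp: shape_def card_gt_0_iff)

lemma shape_insert:
  assumes "finite A" "x \<in> E i" "x \<notin> A"
  shows "shape (insert x A) = (shape A)(i := Suc (shape A i))"
proof
  fix j
  show "shape (insert x A) j = ((shape A)(i := Suc (shape A i))) j"
  proof (cases "j = i")
    case True
    then have "insert x A \<inter> E j = insert x (A \<inter> E i)" using assms by auto
    then show ?thesis using True assms by (simp add: shape_def)
  next
    case False
    then have "x \<notin> E j" using block_unique assms by blast
    then show ?thesis using False by (simp add: shape_def)
  qed
qed

lemma sum_shape:
  assumes "A \<subseteq> base R" "finite A"
  shows "(\<Sum>i<m. shape A i) = card A"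
proof -
  have "A = (\<Union>i<m. A \<inter> E i)" using assms obtain_block by blast
  then have "card A = card (\<Union>i<m. A \<inter> E i)" by simp
  also have "\<dots> = (\<Sum>i<m. card (A \<inter> E i))"
    using assms disjoint by (intro card_UN_disjoint) blast+
  finally show ?thesis by (simp add: shape_def)
qed

lemma ex_subset_of_shape:
  assumes "U \<subseteq> base R" "\<And>i. infinite (U \<inter> E i) \<or> d i \<le> card (U \<inter> E i)"
    and "\<And>i. m \<le> i \<Longrightarrow> d i = 0"
  obtains A where "A \<subseteq> U" "finite A" "shape A = d"
proof -
  have "\<exists>B. B \<subseteq> U \<inter> E i \<and> card B = d i \<and> finite B" for i
    using assms(2)[of i] infinite_arbitrarily_large[of "U \<inter> E i" "d i"]
      obtain_subset_with_card_n[of "d i" "U \<inter> E i"] by (metis finite_subset)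
  then obtain B where B: "\<And>i. B i \<subseteq> U \<inter> E i" "\<And>i. card (B i) = d i" "\<And>i. finite (B i)" by metis
  define A where "A = (\<Union>i<m. B i)"
  have "A \<inter> E i = B i" for i
  proof
    show "A \<inter> E i \<subseteq> B i"
    proof
      fix x assume x: "x \<in> A \<inter> E i"
      then obtain j where "x \<in> B j" by (auto simp: A_def)
      then show "x \<in> B i" using B(1)[of j] block_unique[of x i j] x by auto
    qed
    show "B i \<subseteq> A \<inter> E i" using B(1)[of i] block_less by (fastforce simp: A_def)
  qed
  then have "shape A = d" by (simp add: shape_def B)
  moreover have "A \<subseteq> U" "finite A" using B by (auto simp: A_def)
  ultimately show ?thesis using that by blast
qed

lemma ex_set_of_shape:
  assumes "\<And>i. infinite (E i) \<or> d i \<le> card (E i)"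
  obtains A where "A \<subseteq> base R" "finite A" "shape A = d"
proof -
  have "base R \<inter> E i = E i" for i using block_subset by blast
  moreover have "d i = 0" if "m \<le> i" for i using assms[of i] empty_iff[of i] that by simp
  ultimately show ?thesis using ex_subset_of_shape[of "base R" d] assms that by (metis order_refl)
qed

lemma shape_admissible: "infinite (E i) \<or> shape A i \<le> card (E i)"
  unfolding shape_def by (metis card_mono inf_le2)

lemma same_block_interchangeable:
  assumes "x \<in> E i" "y \<in> E i" "U \<subseteq> base R"
  shows "interchangeable R U x y"
  unfolding interchangeable_def
proof (intro allI impI)
  fix F assume F: "finite F \<and> F \<subseteq> U - {x, y}"
  then have "shape (insert x F) = shape (insert y F)"
    using assms by (subst (1 2) shape_insert[of F _ i]) auto
  moreover have "x \<in> base R" "y \<in> base R" using assms block_subset by blast+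
  ultimately show "iso_on R (insert x F) (insert y F)"
    by (intro same_shape_iso) (use F assms in auto)
qed

text \<open>The base exceeds the number \<open>m\<close> of blocks, so one block of size \<open>t\<close> outweighs any number of
  blocks that are all smaller than \<open>t\<close>.\<close>

definition energy :: "(nat \<Rightarrow> nat) \<Rightarrow> nat" where
  "energy d = (\<Sum>i<m. (m + 2) ^ d i)"

definition better :: "(nat \<Rightarrow> nat) \<Rightarrow> (nat \<Rightarrow> nat) \<Rightarrow> bool" where
  "better d e \<longleftrightarrow> energy d < energy e \<or> energy d = energy e \<and> less_fun d e"

lemma better_asym: "better d e \<Longrightarrow> \<not> better e d"
  using less_fun_asym unfolding better_def by fastforce

lemma better_trans: "better d e \<Longrightarrow> better e f \<Longrightarrow> better d f"
  using less_fun_trans unfolding better_def by fastforce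

lemma better_total:
  "shape A = shape B \<or> better (shape A) (shape B) \<or> better (shape B) (shape A)"
proof -
  have "i < m" if "shape A i \<noteq> shape B i" for i
    using that shape_eq_0[of i A] shape_eq_0[of i B] by (cases "i < m") auto
  then have "{i. shape A i \<noteq> shape B i} \<subseteq> {..<m}" by blast
  then have "finite {i. shape A i \<noteq> shape B i}" by (rule finite_subset) simp
  from less_fun_trichotomy[OF this] show ?thesis
    unfolding better_def by (cases "energy (shape A)" "energy (shape B)" rule: linorder_cases) auto
qed

definition leading :: "(nat \<Rightarrow> nat) \<Rightarrow> bool" where
  "leading d \<longleftrightarrow> (\<exists>A. A \<subseteq> base R \<and> finite A \<and> shape A = d \<and>
     (\<forall>B. B \<subseteq> base R \<and> finite B \<and> iso_on R A B \<longrightarrow> \<not> better d (shape B)))"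

lemma leading_not_better:
  assumes "leading d" "A \<subseteq> base R" "finite A" "shape A = d" "B \<subseteq> base R" "finite B" "iso_on R A B"
  shows "\<not> better d (shape B)"
proof -
  obtain A0 where A0: "A0 \<subseteq> base R" "finite A0" "shape A0 = d"
    "\<And>B. B \<subseteq> base R \<Longrightarrow> finite B \<Longrightarrow> iso_on R A0 B \<Longrightarrow> \<not> better d (shape B)"
    using assms(1) unfolding leading_def by blast
  have "iso_on R A0 A" using A0 assms by (intro same_shape_iso) auto
  then have "iso_on R A0 B" using assms(7) by (rule isomorphic_trans)
  then show ?thesis by (intro A0(4) assms)
qed

lemma leading_eqI:
  assumes "leading d" "leading e" "A \<subseteq> base R" "finite A" "shape A = d"
    "B \<subseteq> base R" "finite B" "shape B = e" "iso_on R A B"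
  shows "d = e"
  using better_total[of A B] leading_not_better[OF assms(1,3,4,5,6,7,9)]
    leading_not_better[OF assms(2,6,7,8,3,4) isomorphic_sym[OF assms(9)]] assms by simp

text \<open>Isomorphic sets have the same size, so only finitely many shapes compete.\<close>

lemma ex_leading:
  assumes A: "A \<subseteq> base R" "finite A"
  obtains B where "B \<subseteq> base R" "finite B" "iso_on R A B" "leading (shape B)"
proof -
  let ?D = "shape ` {B. B \<subseteq> base R \<and> finite B \<and> iso_on R A B}"
  have "finite ?D"
  proof (rule finite_subset)
    show "?D \<subseteq> {d. \<forall>i. (i \<in> {..<m} \<longrightarrow> d i \<in> {..card A}) \<and> (i \<notin> {..<m} \<longrightarrow> d i = 0)}"
    proof (intro subsetI CollectI allI conjI impI)
      fix d i assume "d \<in> ?D"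
      then obtain B where B: "B \<subseteq> base R" "finite B" "iso_on R A B" "d = shape B" by blast
      show "d i = 0" if "i \<notin> {..<m}" using that B shape_eq_0 by simp
      have "shape B i \<le> card B" unfolding shape_def by (rule card_mono) (use B in auto)
      then show "d i \<in> {..card A}" using B iso_on_card_eq[OF B(3)] by simp
    qed
    show "finite {d. \<forall>i. (i \<in> {..<m} \<longrightarrow> d i \<in> {..card A}) \<and> (i \<notin> {..<m} \<longrightarrow> d i = (0::nat))}"
      by (intro finite_set_of_finite_funs) auto
  qed
  moreover have "asymp_on ?D better" using better_asym by (auto intro: asymp_onI)
  moreover have "transp_on ?D better" using better_trans by (blast intro: transp_onI)
  moreover have "?D \<noteq> {}" using A isomorphic_refl by blast
  ultimately have "\<exists>d\<in>?D. \<forall>e\<in>?D. e \<noteq> d \<longrightarrow> \<not> better d e"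
    by (rule Finite_Set.bex_max_element)
  then obtain d where d: "d \<in> ?D" "\<forall>e\<in>?D. e \<noteq> d \<longrightarrow> \<not> better d e" by (elim bexE)
  then obtain B where B: "B \<subseteq> base R" "finite B" "iso_on R A B" "d = shape B" by blast
  have "\<not> better d (shape C)" if C: "C \<subseteq> base R" "finite C" "iso_on R B C" for C
  proof -
    have "iso_on R A C" using B(3) C(3) by (rule isomorphic_trans)
    then have "shape C \<in> ?D" using C by blast
    then show ?thesis using d(2) better_asym[of d d] by metis
  qed
  then have "leading (shape B)" using B unfolding leading_def by blast
  then show ?thesis using that B by blast
qed

lemma profile_eq_card_leading:
  "profile R n = card {d. leading d \<and> (\<Sum>i<m. d i) = n}"
proof -
  let ?L = "{d. leading d \<and> (\<Sum>i<m. d i) = n}"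
  define rep where "rep d = (SOME A. A \<subseteq> base R \<and> finite A \<and> shape A = d)" for d
  define cls where "cls d = same_type R n `` {rep d}" for d
  have rep: "rep d \<subseteq> base R \<and> finite (rep d) \<and> shape (rep d) = d" if "leading d" for d
    unfolding rep_def by (rule someI_ex) (use that in \<open>auto simp: leading_def\<close>)
  have size: "rep d \<in> subsets_of_size R n" if "d \<in> ?L" for d
    using rep[of d] sum_shape[of "rep d"] that by (auto simp: subsets_of_size_def)
  have "bij_betw cls ?L (isomorphism_types R n)"
    unfolding bij_betw_def
  proof
    show "inj_on cls ?L"
    proof (rule inj_onI)
      fix d e assume d: "d \<in> ?L" and e: "e \<in> ?L" and eq: "cls d = cls e"
      have "(rep d, rep e) \<in> same_type R n"
        using eq_equiv_class[OF eq[unfolded cls_def] equiv_same_type size[OF e]] .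
      then have "iso_on R (rep d) (rep e)" by (simp add: same_type_def)
      then show "d = e" using d e rep[of d] rep[of e] by (intro leading_eqI[of d e "rep d" "rep e"]) auto
    qed
    show "cls ` ?L = isomorphism_types R n"
    proof
      show "cls ` ?L \<subseteq> isomorphism_types R n"
        using size by (auto simp: cls_def isomorphism_types_def intro: quotientI)
      show "isomorphism_types R n \<subseteq> cls ` ?L"
      proof
        fix c assume "c \<in> isomorphism_types R n"
        then obtain A where A: "A \<in> subsets_of_size R n" "c = same_type R n `` {A}"
          unfolding isomorphism_types_def by (rule quotientE)
        then have A': "A \<subseteq> base R" "finite A" "card A = n" by (auto simp: subsets_of_size_def)
        obtain B where B: "B \<subseteq> base R" "finite B" "iso_on R A B" "leading (shape B)"
          using ex_leading[OF A'(1,2)] .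
        have "card B = n" using iso_on_card_eq[OF B(3)] A' by simp
        then have L: "shape B \<in> ?L" using B sum_shape by simp
        have "iso_on R B (rep (shape B))" using B rep[OF B(4)] by (intro same_shape_iso) auto
        then have "iso_on R A (rep (shape B))" by (rule isomorphic_trans[OF B(3)])
        then have "(A, rep (shape B)) \<in> same_type R n"
          using A(1) size[OF L] by (simp add: same_type_def)
        then have "c = cls (shape B)"
          unfolding A(2) cls_def by (rule equiv_class_eq[OF equiv_same_type])
        then show "c \<in> cls ` ?L" using L by blast
      qed
    qed
  qed
  then show ?thesis unfolding profile_def by (metis bij_betw_same_card)
qed

lemma energy_update:
  assumes "i < m"
  shows "energy (d(i := v)) + (m + 2) ^ d i = energy d + (m + 2) ^ v"
proof -
  have "energy (d(i := v)) = (m + 2) ^ v + (\<Sum>j\<in>{..<m} - {i}. (m + 2) ^ (d(i := v)) j)"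
    unfolding energy_def using assms by (subst sum.remove[of _ i]) auto
  also have "(\<Sum>j\<in>{..<m} - {i}. (m + 2) ^ (d(i := v)) j) = (\<Sum>j\<in>{..<m} - {i}. (m + 2) ^ d j)"
    by (rule sum.cong) auto
  finally show ?thesis
    unfolding energy_def using assms by (subst sum.remove[of _ i]) auto
qed

text \<open>Convexity of the exponential function: moving a point from a block to another one that is at least as
  large increases the energy.\<close>

lemma energy_move:
  assumes "x < m" "y < m" "x \<noteq> y" "Suc v = d y" "d y \<le> d x"
  shows "energy d < energy (d(y := v, x := Suc (d x)))"
proof -
  let ?N = "m + 2" and ?e = "d(y := v)"
  have 1: "energy ?e + ?N ^ Suc v = energy d + ?N ^ v"
    using energy_update[OF assms(2), of d v] assms(4) by simp
  have 2: "energy (?e(x := Suc (d x))) + ?N ^ d x = energy ?e + ?N ^ Suc (d x)"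
    using energy_update[OF assms(1), of ?e "Suc (d x)"] assms(3) by simp
  have "?N ^ v < ?N ^ d x" using assms(4,5) by (intro power_strict_increasing) auto
  then have "(m + 1) * ?N ^ v < (m + 1) * ?N ^ d x" by (intro mult_strict_left_mono) auto
  then have "?N ^ Suc v + ?N ^ d x < ?N ^ Suc (d x) + ?N ^ v" by simp
  then show ?thesis using 1 2 by linarith
qed

lemma energy_raise:
  assumes "S \<subseteq> {..<m}"
  shows "energy (raise S d) = energy d + (m + 1) * (\<Sum>i\<in>S. (m + 2) ^ d i)"
proof -
  have split: "energy e = (\<Sum>i\<in>{..<m} - S. (m + 2) ^ e i) + (\<Sum>i\<in>S. (m + 2) ^ e i)" for e
    unfolding energy_def by (rule sum.subset_diff[OF assms]) simp
  have "(\<Sum>i\<in>{..<m} - S. (m + 2) ^ raise S d i) = (\<Sum>i\<in>{..<m} - S. (m + 2) ^ d i)"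
    by (rule sum.cong) (auto simp: raise_def)
  moreover have "(\<Sum>i\<in>S. (m + 2) ^ raise S d i) = (m + 2) * (\<Sum>i\<in>S. (m + 2) ^ d i)"
    unfolding sum_distrib_left by (rule sum.cong) (auto simp: raise_def)
  ultimately show ?thesis unfolding split[of "raise S d"] split[of d] by simp
qed

text \<open>Were \<open>a\<close> and \<open>b\<close> interchangeable in \<open>A\<close>, then a subset of \<open>A\<close> of shape \<open>d\<close> that contains \<open>b\<close> but not
  \<open>a\<close> could swap them, which moves a point from block \<open>y\<close> to block \<open>x\<close> and increases the energy.\<close>

lemma not_interchangeable_if_leading:
  assumes d: "leading d" and A: "A \<subseteq> base R" "finite A" "\<And>i. d i \<le> shape A i"
    and a: "a \<in> A" "a \<in> E x" "d x < shape A x" and b: "b \<in> A" "b \<in> E y" "0 < d y"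
    and xy: "x \<noteq> y" "d y \<le> d x"
  shows "\<not> interchangeable R A a b"
proof
  assume int: "interchangeable R A a b"
  obtain v where v: "Suc v = d y" using b(3) by (metis Suc_pred)
  have ab: "a \<noteq> b" using a b xy block_unique by blast
  let ?U = "A - {a, b}"
  have "A = insert a (insert b ?U)" using a b by auto
  then have "shape A = shape (insert a (insert b ?U))" by simp
  also have "\<dots> = (shape ?U)(y := Suc (shape ?U y), x := Suc (shape ?U x))"
    using A(2) a b ab xy by (simp add: shape_insert[of _ a x] shape_insert[of _ b y])
  finally have shU: "shape A = (shape ?U)(y := Suc (shape ?U y), x := Suc (shape ?U x))" .
  have "(d(y := v)) i \<le> shape ?U i" for i
    using A(3)[of i] a(3) v xy unfolding shU by (auto split: if_splits)
  then have "infinite (?U \<inter> E i) \<or> (d(y := v)) i \<le> card (?U \<inter> E i)" for i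
    unfolding shape_def by blast
  moreover have "(d(y := v)) i = 0" if "m \<le> i" for i
    using A(3)[of i] shape_eq_0[OF that, of A] block_less[OF b(2)] that by auto
  moreover have "?U \<subseteq> base R" using A by blast
  ultimately obtain B where B: "B \<subseteq> ?U" "finite B" "shape B = d(y := v)"
    using ex_subset_of_shape[of ?U "d(y := v)"] by blast
  have "iso_on R (insert a B) (insert b B)"
    using int B by (intro interchangeableD) auto
  then have iso: "iso_on R (insert b B) (insert a B)" by (rule isomorphic_sym)
  have nin: "a \<notin> B" "b \<notin> B" using B by auto
  have sb: "shape (insert b B) = d" using B v b nin by (simp add: shape_insert[of _ b y])
  have sa: "shape (insert a B) = d(y := v, x := Suc (d x))"
    using B a nin xy by (simp add: shape_insert[of _ a x])
  have "energy d < energy (shape (insert a B))"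
    unfolding sa using block_less[OF a(2)] block_less[OF b(2)] xy v by (intro energy_move) auto
  then have "better d (shape (insert a B))" by (simp add: better_def)
  moreover have "\<not> better d (shape (insert a B))"
    by (rule leading_not_better[OF d _ _ sb _ _ iso]) (use A a b B in auto)
  ultimately show False by simp
qed

text \<open>Of the two blocks, the one that is larger in \<open>d\<close> belongs to the layer and has a spare point in
  \<open>A\<close>, so it can play the role of the receiving block.\<close>

lemma leading_layer_isolated:
  assumes d: "leading d" and t: "t > 0"
    and A: "A \<subseteq> base R" "finite A" "shape A = raise (layer t d) d"
    and a: "a \<in> A" "a \<in> E x" "x \<in> layer t d" and b: "b \<in> A" "b \<in> E y" "x \<noteq> y"
  shows "\<not> interchangeable R A a b"
proof -
  have le: "d i \<le> shape A i" for i by (simp add: A(3) raise_def)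
  have dx: "t \<le> d x" "d x < shape A x" using a by (simp_all add: A(3) raise_def layer_def)
  show ?thesis
  proof (cases "d y \<le> d x")
    case True
    have "0 < d y"
    proof (cases "y \<in> layer t d")
      case False
      then show ?thesis using shape_pos[OF A(2) b(1,2)] by (simp add: A(3) raise_def)
    qed (use t in \<open>simp add: layer_def\<close>)
    then show ?thesis
      using not_interchangeable_if_leading[OF d A(1,2) le a(1,2) dx(2) b(1,2)] b(3) True by simp
  next
    case False
    then have "y \<in> layer t d" using dx by (simp add: layer_def)
    then have "d y < shape A y" by (simp add: A(3) raise_def)
    then have "\<not> interchangeable R A b a"
      using not_interchangeable_if_leading[OF d A(1,2) le b(1,2) _ a(1,2)] b(3) False dx t by simp
    then show ?thesis using interchangeable_sym by metis
  qed
qed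

text \<open>Removing one point from blocks that are at most as large costs at most as much energy, so the strict
  case is clear. In a tie, corresponding blocks have equal sizes, and the remaining blocks on the right
  are smaller than \<open>t\<close> because their total energy is that of the blocks outside the layer. Then
  both sides are obtained by the same map, which lowers the values above \<open>t\<close> by one and keeps
  those below \<open>t\<close>; it is increasing on the values that occur, so it preserves the lexicographic order.\<close>

lemma better_of_raise:
  assumes t: "t > 0" and S: "S = layer t d" "S \<subseteq> {..<m}" and y: "inj_on y S" "y ` S \<subseteq> {..<m}"
    and le: "\<And>x. x \<in> S \<Longrightarrow> d' (y x) \<le> d x" and supp: "\<And>i. m \<le> i \<Longrightarrow> d' i = 0"
    and better: "better (raise S d) (raise (y ` S) d')"
  shows "better d d'"
proof -
  let ?N = "m + 2"
  have finS: "finite S" using S(2) finite_subset by blast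
  have e: "energy (raise S d) = energy d + (m + 1) * (\<Sum>x\<in>S. ?N ^ d x)"
    by (rule energy_raise[OF S(2)])
  have e': "energy (raise (y ` S) d') = energy d' + (m + 1) * (\<Sum>x\<in>S. ?N ^ d' (y x))"
    using energy_raise[OF y(2)] by (simp add: sum.reindex[OF y(1)])
  have pow: "?N ^ d' (y x) \<le> ?N ^ d x" if "x \<in> S" for x
    using le[OF that] by (intro power_increasing) auto
  then have sums: "(\<Sum>x\<in>S. ?N ^ d' (y x)) \<le> (\<Sum>x\<in>S. ?N ^ d x)" by (rule sum_mono)
  then have sums': "(m + 1) * (\<Sum>x\<in>S. ?N ^ d' (y x)) \<le> (m + 1) * (\<Sum>x\<in>S. ?N ^ d x)"
    by (rule mult_left_mono) simp
  have ge: "energy (raise S d) \<le> energy (raise (y ` S) d')" using better by (auto simp: better_def)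
  show ?thesis
  proof (cases "energy d < energy d'")
    case False
    then have eqs: "(m + 1) * (\<Sum>x\<in>S. ?N ^ d' (y x)) = (m + 1) * (\<Sum>x\<in>S. ?N ^ d x)"
      "energy d' = energy d" "energy (raise S d) = energy (raise (y ` S) d')"
      using ge sums' e e' by linarith+
    then have sum_eq: "(\<Sum>x\<in>S. ?N ^ d' (y x)) = (\<Sum>x\<in>S. ?N ^ d x)"
      unfolding mult_cancel1 by simp
    have same: "d' (y x) = d x" if x: "x \<in> S" for x
    proof -
      have "?N ^ d' (y x) = ?N ^ d x"
        using sum_mono_inv[OF sum_eq pow x finS] .
      then show ?thesis by (simp add: power_inject_exp)
    qed
    have small: "d' i < t" if i: "i \<notin> y ` S" for i
    proof (cases "i < m")
      case True
      have split: "energy f = (\<Sum>i\<in>{..<m} - T. ?N ^ f i) + (\<Sum>i\<in>T. ?N ^ f i)" if "T \<subseteq> {..<m}" for f T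
        unfolding energy_def by (rule sum.subset_diff[OF that]) simp
      have "?N ^ d' i \<le> (\<Sum>i\<in>{..<m} - y ` S. ?N ^ d' i)"
        using True i by (intro member_le_sum) auto
      also have "\<dots> = (\<Sum>i\<in>{..<m} - S. ?N ^ d i)"
        using split[OF S(2), of d] split[OF y(2), of d'] eqs(2) sum_eq
        by (simp add: sum.reindex[OF y(1)])
      also have "\<dots> \<le> (\<Sum>i\<in>{..<m} - S. ?N ^ (t - 1))"
        using S(1) t by (intro sum_mono power_increasing) (auto simp: layer_def)
      also have "\<dots> \<le> m * ?N ^ (t - 1)"
        by (simp add: card_Diff_subset[OF finS S(2)])
      also have "\<dots> < ?N * ?N ^ (t - 1)" by (intro mult_strict_right_mono) auto
      also have "\<dots> = ?N ^ t" using t by (simp add: power_eq_if)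
      finally show ?thesis by (simp add: power_strict_increasing_iff)
    next
      case False
      then show ?thesis using supp t by simp
    qed
    have big: "t \<le> d' i" if "i \<in> y ` S" for i
      using that same S(1) by (auto simp: layer_def)
    have dS: "i \<in> S \<longleftrightarrow> t \<le> d i" for i using S(1) by (simp add: layer_def)
    have "less_fun (raise S d) (raise (y ` S) d')"
      using better eqs(3) by (auto simp: better_def)
    then obtain k where k: "raise S d k < raise (y ` S) d' k"
      "\<And>j. j < k \<Longrightarrow> raise S d j = raise (y ` S) d' j" by (blast elim!: less_funE)
    have "d k < d' k"
      using k(1) small[of k] big[of k] dS[of k] unfolding raise_def
      by (cases "k \<in> S"; cases "k \<in> y ` S") auto
    moreover have "d j = d' j" if "j < k" for j
      using k(2)[OF that] small[of j] big[of j] dS[of j] unfolding raise_def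
      by (cases "j \<in> S"; cases "j \<in> y ` S") auto
    ultimately have "less_fun d d'" by (auto simp: less_fun_def)
    then show ?thesis using eqs by (simp add: better_def)
  qed (simp add: better_def)
qed

lemma shape_Diff_transversal:
  assumes A: "finite A" and T: "T \<subseteq> A" "T \<subseteq> base R"
    and one: "\<And>a b i. a \<in> T \<Longrightarrow> b \<in> T \<Longrightarrow> a \<in> E i \<Longrightarrow> b \<in> E i \<Longrightarrow> a = b"
  shows "shape A = raise {i. T \<inter> E i \<noteq> {}} (shape (A - T))"
proof
  fix i
  show "shape A i = raise {i. T \<inter> E i \<noteq> {}} (shape (A - T)) i"
  proof (cases "T \<inter> E i = {}")
    case True
    then have "(A - T) \<inter> E i = A \<inter> E i" by blast
    then show ?thesis using True by (simp add: raise_def shape_def)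
  next
    case False
    then obtain a where a: "a \<in> T" "a \<in> E i" by blast
    then have "A \<inter> E i = insert a ((A - T) \<inter> E i)" using T one[OF a(1) _ a(2)] by blast
    moreover have "a \<notin> (A - T) \<inter> E i" using a by blast
    ultimately have "card (A \<inter> E i) = Suc (card ((A - T) \<inter> E i))" using A by simp
    then show ?thesis using False by (simp add: raise_def shape_def)
  qed
qed

lemma raise_inject: "raise S d = raise S e \<Longrightarrow> d = e"
  by (rule ext, drule fun_cong) (auto simp: raise_def split: if_splits)

text \<open>The closure property that makes the profile rational. In the proof, \<open>g\<close> maps a set \<open>B\<close> of a supposedly
  better shape onto \<open>A\<close>, and \<open>b x\<close> is a point of \<open>B\<close>, in block \<open>y x\<close>, that \<open>g\<close> sends into block \<open>x\<close> of the layer.\<close>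

theorem leading_raise_layer:
  assumes d: "leading d" and t: "t > 0" and inf: "\<And>i. i \<in> layer t d \<Longrightarrow> infinite (E i)"
  shows "leading (raise (layer t d) d)"
proof -
  let ?S = "layer t d"
  obtain D where D: "D \<subseteq> base R" "finite D" "shape D = d" using d unfolding leading_def by blast
  have "infinite (E i) \<or> raise ?S d i \<le> card (E i)" for i
    using inf[of i] shape_admissible[of i D] by (auto simp: raise_def D(3))
  then obtain A where A: "A \<subseteq> base R" "finite A" "shape A = raise ?S d"
    by (rule ex_set_of_shape)
  have "\<not> better (raise ?S d) (shape B)" if B: "B \<subseteq> base R" "finite B" "iso_on R A B" for B
  proof
    assume bet: "better (raise ?S d) (shape B)"
    obtain g where g: "hereditary_iso R g B A"
      using iso_on_hereditary[OF isomorphic_sym[OF B(3)]] .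
    have bij: "bij_betw g B A" by (rule hereditary_isoD(1)[OF g])
    have "\<exists>b y. b \<in> B \<and> g b \<in> E x \<and> b \<in> E y" if x: "x \<in> ?S" for x
    proof -
      have "shape A x \<noteq> 0" using x by (simp add: A(3) raise_def)
      then obtain a where a: "a \<in> A" "a \<in> E x" unfolding shape_def by (metis card.empty disjoint_iff)
      then obtain b where b: "b \<in> B" "g b = a" using bij by (auto simp: bij_betw_def)
      then obtain y where "b \<in> E y" using obtain_block B(1) by blast
      then show ?thesis using a b by blast
    qed
    then obtain b y where sel: "\<And>x. x \<in> ?S \<Longrightarrow> b x \<in> B" "\<And>x. x \<in> ?S \<Longrightarrow> g (b x) \<in> E x"
      "\<And>x. x \<in> ?S \<Longrightarrow> b x \<in> E (y x)" by metis
    have gA: "g c \<in> A" if "c \<in> B" for c using bij that by (auto simp: bij_betw_def)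
    have into: "g ` (B \<inter> E (y x)) \<subseteq> A \<inter> E x" if x: "x \<in> ?S" for x
    proof
      fix a assume "a \<in> g ` (B \<inter> E (y x))"
      then obtain c where c: "c \<in> B" "c \<in> E (y x)" "a = g c" by blast
      have "interchangeable R B (b x) c"
        by (rule same_block_interchangeable[OF sel(3)[OF x] c(2) B(1)])
      then have int: "interchangeable R A (g (b x)) (g c)"
        by (rule interchangeable_transfer[OF g sel(1)[OF x] c(1)])
      obtain z where z: "g c \<in> E z" using obtain_block gA[OF c(1)] A(1) by blast
      have "x = z"
        using leading_layer_isolated[OF d t A gA[OF sel(1)[OF x]] sel(2)[OF x] x gA[OF c(1)] z] int
        by blast
      then show "a \<in> A \<inter> E x" using z c gA by blast
    qed
    have inj: "inj_on y ?S"
    proof (rule inj_onI)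
      fix x x' assume x: "x \<in> ?S" "x' \<in> ?S" "y x = y x'"
      then have "g (b x') \<in> E x" using into[OF x(1)] sel(1,3)[OF x(2)] by auto
      then show "x = x'" using sel(2)[OF x(2)] block_unique by blast
    qed
    \<comment> \<open>Both sets lose a transversal of the layer; \<open>A\<close> is back at shape \<open>d\<close>.\<close>
    let ?T = "b ` ?S" and ?T' = "g ` b ` ?S"
    have "{i. ?T \<inter> E i \<noteq> {}} = y ` ?S"
      using sel(3) block_unique by blast
    moreover have "shape B = raise {i. ?T \<inter> E i \<noteq> {}} (shape (B - ?T))"
    proof (rule shape_Diff_transversal[OF B(2)])
      show "?T \<subseteq> B" using sel(1) by blast
      then show "?T \<subseteq> base R" using B(1) by blast
      fix a c i assume a: "a \<in> ?T" "c \<in> ?T" "a \<in> E i" "c \<in> E i"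
      then obtain x z where x: "x \<in> ?S" "a = b x" "z \<in> ?S" "c = b z" by blast
      then have "y x = y z" using a sel(3)[OF x(1)] sel(3)[OF x(3)] block_unique by metis
      then show "a = c" using inj x by (metis inj_onD)
    qed
    ultimately have shB: "shape B = raise (y ` ?S) (shape (B - ?T))" by simp
    have "{i. ?T' \<inter> E i \<noteq> {}} = ?S"
      using sel(2) block_unique by blast
    moreover have "shape A = raise {i. ?T' \<inter> E i \<noteq> {}} (shape (A - ?T'))"
    proof (rule shape_Diff_transversal[OF A(2)])
      show "?T' \<subseteq> A" using sel(1) gA by blast
      then show "?T' \<subseteq> base R" using A(1) by blast
      fix a c i assume a: "a \<in> ?T'" "c \<in> ?T'" "a \<in> E i" "c \<in> E i"
      then obtain x z where x: "x \<in> ?S" "a = g (b x)" "z \<in> ?S" "c = g (b z)" by blast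
      then have "x = z" using a sel(2)[OF x(1)] sel(2)[OF x(3)] block_unique by metis
      then show "a = c" using x by simp
    qed
    ultimately have "raise ?S d = raise ?S (shape (A - ?T'))" using A(3) by simp
    then have shA: "shape (A - ?T') = d" by (metis raise_inject)
    have "iso_on R (B - ?T) (g ` (B - ?T))" by (rule hereditary_isoD(2)[OF g]) blast
    moreover have "g ` (B - ?T) = A - ?T'"
      using bij sel(1) by (subst inj_on_image_set_diff[of g B]) (auto simp: bij_betw_def)
    ultimately have "iso_on R (A - ?T') (B - ?T)" by (simp add: isomorphic_sym)
    then have not: "\<not> better d (shape (B - ?T))"
      by (intro leading_not_better[OF d _ _ shA]) (use A B in auto)
    have "better d (shape (B - ?T))"
    proof (rule better_of_raise[OF t refl _ inj])
      show "?S \<subseteq> {..<m}" using sel(2) block_less by blast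
      show "y ` ?S \<subseteq> {..<m}" using sel(3) block_less by blast
      show "shape (B - ?T) i = 0" if "m \<le> i" for i by (rule shape_eq_0[OF that])
      show "better (raise ?S d) (raise (y ` ?S) (shape (B - ?T)))" using bet shB by simp
      fix x assume x: "x \<in> ?S"
      have "shape B (y x) \<le> shape A x"
        unfolding shape_def
      proof (rule card_inj_on_le)
        show "inj_on g (B \<inter> E (y x))" using bij by (auto simp: bij_betw_def intro: inj_on_subset)
        show "g ` (B \<inter> E (y x)) \<subseteq> A \<inter> E x" by (rule into[OF x])
      qed (use A in simp)
      then show "shape (B - ?T) (y x) \<le> d x" using x unfolding shB A(3) by (simp add: raise_def)
    qed
    then show False using not by simp
  qed
  then show ?thesis using A unfolding leading_def by blast
qed

end

section \<open>Lower bound for the profile\<close>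

lemma card_le_fibres:
  assumes "finite T" "f ` V \<subseteq> T" "\<And>v. v \<in> V \<Longrightarrow> card {u \<in> V. f u = f v} \<le> M" "finite V"
  shows "card V \<le> M * card T"
proof -
  have "card V = (\<Sum>t\<in>f ` V. card {u \<in> V. f u = t})"
    using sum.image_gen[OF assms(4), of "\<lambda>_. 1 :: nat" f] by (simp only: card_eq_sum)
  also have "\<dots> \<le> (\<Sum>t\<in>f ` V. M)"
    using assms(3) by (intro sum_mono) auto
  also have "\<dots> \<le> M * card T"
    using card_mono[OF assms(1,2)] by simp
  finally show ?thesis .
qed

locale minimal_indexed_decomposition = indexed_decomposition +
  assumes separated: "i \<noteq> j \<Longrightarrow> x \<in> E i \<Longrightarrow> y \<in> E j \<Longrightarrow> \<not> interchangeable R (base R) x y"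
begin

text \<open>In a large set the interchangeability classes are exactly its intersections with the blocks,
  so the blocks can be recovered from the restriction alone.\<close>

definition large :: "'a set \<Rightarrow> bool" where
  "large A \<longleftrightarrow> (\<forall>i<m. A \<inter> E i \<noteq> {}) \<and>
     (\<forall>i j a b. i \<noteq> j \<longrightarrow> a \<in> A \<inter> E i \<longrightarrow> b \<in> A \<inter> E j \<longrightarrow> \<not> interchangeable R A a b)"

lemma large_meets_block: "large A \<Longrightarrow> i < m \<Longrightarrow> \<exists>a. a \<in> A \<inter> E i"
  unfolding large_def ex_in_conv by blast

lemma large_separates:
  "large A \<Longrightarrow> i \<noteq> j \<Longrightarrow> a \<in> A \<Longrightarrow> a \<in> E i \<Longrightarrow> b \<in> A \<Longrightarrow> b \<in> E j \<Longrightarrow> \<not> interchangeable R A a b"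
  by (simp add: large_def)

lemma obtain_separating_set:
  assumes "i < m" "j < m" "i \<noteq> j"
  obtains x y F where "x \<in> E i" "y \<in> E j" "finite F" "F \<subseteq> base R - {x, y}"
    "\<not> iso_on R (insert x F) (insert y F)"
proof -
  obtain x y where xy: "x \<in> E i" "y \<in> E j" using assms empty_iff by (metis ex_in_conv not_le)
  then have "\<not> interchangeable R (base R) x y" using separated assms(3) by blast
  then show ?thesis using that xy unfolding interchangeable_def by blast
qed

text \<open>A set \<open>F\<close> that tells \<open>x\<close> from \<open>y\<close> can be copied, with the same shape, into every \<open>A\<close> that has enough points in
  each block, while avoiding two given points \<open>a\<close> and \<open>b\<close> of the same blocks.\<close>

lemma separating_set_transfer:
  assumes W: "x \<in> E i" "y \<in> E j" "i \<noteq> j" "finite F" "F \<subseteq> base R - {x, y}"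
    "\<not> iso_on R (insert x F) (insert y F)"
    and A: "A \<subseteq> base R" "finite A" "\<And>l. shape (insert x (insert y F)) l \<le> shape A l"
    and ab: "a \<in> A" "a \<in> E i" "b \<in> A" "b \<in> E j"
  shows "\<not> interchangeable R A a b"
proof
  assume int: "interchangeable R A a b"
  let ?U = "A - {a, b}"
  have neq: "a \<noteq> b" "x \<noteq> y" using ab W block_unique by blast+
  have "A = insert a (insert b ?U)" using ab by auto
  then have "shape A = shape (insert a (insert b ?U))" by simp
  also have "\<dots> = (shape ?U)(j := Suc (shape ?U j), i := Suc (shape ?U i))"
    using A(2) ab W(3) neq by (simp add: shape_insert[of _ a i] shape_insert[of _ b j])
  finally have shU: "shape A = (shape ?U)(j := Suc (shape ?U j), i := Suc (shape ?U i))" .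
  have xyF: "x \<notin> F" "y \<notin> F" using W(5) by auto
  then have "shape (insert x (insert y F)) = (shape F)(j := Suc (shape F j), i := Suc (shape F i))"
    using W neq by (simp add: shape_insert[of _ x i] shape_insert[of _ y j])
  then have "shape F l \<le> shape ?U l" for l
    using A(3)[of l] W(3) unfolding shU by (auto split: if_splits)
  then have room: "infinite (?U \<inter> E l) \<or> shape F l \<le> card (?U \<inter> E l)" for l
    by (simp add: shape_def)
  have U: "?U \<subseteq> base R" using A by blast
  obtain G where G: "G \<subseteq> ?U" "finite G" "shape G = shape F"
    using ex_subset_of_shape[OF U room shape_eq_0] .
  have ins: "iso_on R (insert z F) (insert c G)"
    if "z \<in> E l" "c \<in> E l" "z \<notin> F" "c \<notin> G" for z c l
  proof (rule same_shape_iso)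
    show "shape (insert z F) = shape (insert c G)"
      using that G W(4) by (simp add: shape_insert[of _ _ l])
    show "insert z F \<subseteq> base R" "insert c G \<subseteq> base R"
      using that block_subset[of l] W(5) G(1) A(1) by blast+
  qed (use W G in auto)
  have "iso_on R (insert x F) (insert a G)" using ins[of x i a] W ab G by blast
  moreover have "iso_on R (insert a G) (insert b G)" using int G by (intro interchangeableD) auto
  moreover have "iso_on R (insert b G) (insert y F)"
    using ins[of y j b] W ab G isomorphic_sym by blast
  ultimately have "iso_on R (insert x F) (insert y F)" by (meson isomorphic_trans)
  then show False using W(6) by simp
qed

text \<open>The threshold contains, for every pair of blocks, two points and a set separating them, and one point
  of every block.\<close>

lemma ex_large_threshold:
  obtains W where "W \<subseteq> base R" "finite W"
    "\<And>A. A \<subseteq> base R \<Longrightarrow> finite A \<Longrightarrow> (\<And>l. shape W l \<le> shape A l) \<Longrightarrow> large A"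
proof -
  define P where "P i j V \<longleftrightarrow> V \<subseteq> base R \<and> finite V \<and> (i < m \<longrightarrow> j < m \<longrightarrow> i \<noteq> j \<longrightarrow>
    (\<exists>x\<in>E i. \<exists>y\<in>E j. \<exists>F. finite F \<and> F \<subseteq> base R - {x, y} \<and> V = insert x (insert y F) \<and>
      \<not> iso_on R (insert x F) (insert y F)))" for i j V
  have "\<exists>V. P i j V" for i j
  proof (cases "i < m \<and> j < m \<and> i \<noteq> j")
    case True
    then obtain x y F where F: "x \<in> E i" "y \<in> E j" "finite F" "F \<subseteq> base R - {x, y}"
      "\<not> iso_on R (insert x F) (insert y F)" using obtain_separating_set[of i j] by blast
    then have "insert x (insert y F) \<subseteq> base R" using block_subset[of i] block_subset[of j] by blast
    then have "P i j (insert x (insert y F))" using F unfolding P_def by blast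
    then show ?thesis by blast
  next
    case False
    then have "P i j {}" by (auto simp: P_def)
    then show ?thesis by blast
  qed
  then obtain V where V: "\<And>i j. P i j (V i j)" by metis
  then have Vsub: "V i j \<subseteq> base R" "finite (V i j)" for i j by (simp_all add: P_def)
  have "\<exists>p. p \<in> E i" if "i < m" for i using empty_iff[of i] that by (metis ex_in_conv not_le)
  then obtain p where p: "\<And>i. i < m \<Longrightarrow> p i \<in> E i" by metis
  define W where "W = (\<Union>i<m. \<Union>j<m. V i j) \<union> p ` {..<m}"
  have "p ` {..<m} \<subseteq> base R" using p block_subset by blast
  then have W: "W \<subseteq> base R" "finite W"
    unfolding W_def using Vsub by (blast, simp)
  moreover have "large A" if A: "A \<subseteq> base R" "finite A" "\<And>l. shape W l \<le> shape A l" for A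
    unfolding large_def
  proof (intro conjI allI impI)
    fix i assume i: "i < m"
    have "p i \<in> W" using i by (auto simp: W_def)
    then have "0 < shape W i" using shape_pos[OF W(2)] p[OF i] by blast
    then have "0 < shape A i" using A(3)[of i] by linarith
    then show "A \<inter> E i \<noteq> {}" by (auto simp: shape_def)
  next
    fix i j a b assume ij: "i \<noteq> j" and a: "a \<in> A \<inter> E i" and b: "b \<in> A \<inter> E j"
    then have ijm: "i < m" "j < m" using block_less by blast+
    then obtain x y F where F: "x \<in> E i" "y \<in> E j" "finite F" "F \<subseteq> base R - {x, y}"
      "V i j = insert x (insert y F)" "\<not> iso_on R (insert x F) (insert y F)"
      using V[of i j] ij unfolding P_def by blast
    have "shape (insert x (insert y F)) l \<le> shape A l" for l
    proof -
      have "V i j \<subseteq> W" using ijm by (auto simp: W_def)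
      then have "shape (V i j) l \<le> shape W l"
        unfolding shape_def using W(2) by (intro card_mono) auto
      then show ?thesis using A(3)[of l] F(5) by simp
    qed
    then show "\<not> interchangeable R A a b"
      using separating_set_transfer[OF F(1,2) ij F(3,4,6) A(1,2)] a b by blast
  qed
  ultimately show ?thesis by (rule that)
qed

lemma large_iso_permutes_shape:
  assumes A: "A \<subseteq> base R" "finite A" "large A" and B: "B \<subseteq> base R" "finite B" "large B"
    and iso: "iso_on R A B"
  obtains \<pi> where "bij_betw \<pi> {..<m} {..<m}" "\<And>i. i < m \<Longrightarrow> shape B (\<pi> i) = shape A i"
proof -
  obtain g where g: "hereditary_iso R g A B" using iso_on_hereditary[OF iso] .
  have bij: "bij_betw g A B" by (rule hereditary_isoD(1)[OF g])
  have gB: "g a \<in> B" if "a \<in> A" for a using bij that by (auto simp: bij_betw_def)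
  have forward: "k = l" if "a \<in> A" "b \<in> A" "a \<in> E i" "b \<in> E i" "g a \<in> E k" "g b \<in> E l" for a b i k l
  proof (rule ccontr)
    assume "k \<noteq> l"
    have "interchangeable R A a b" by (rule same_block_interchangeable[OF that(3,4) A(1)])
    then have "interchangeable R B (g a) (g b)"
      by (rule interchangeable_transfer[OF g that(1,2)])
    then show False
      using large_separates[OF B(3) \<open>k \<noteq> l\<close> gB[OF that(1)] that(5) gB[OF that(2)] that(6)] by simp
  qed
  have backward: "k = l" if "a \<in> A" "b \<in> A" "a \<in> E k" "b \<in> E l" "g a \<in> E i" "g b \<in> E i" for a b i k l
  proof (rule ccontr)
    assume "k \<noteq> l"
    have "interchangeable R B (g a) (g b)" by (rule same_block_interchangeable[OF that(5,6) B(1)])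
    then have "interchangeable R A (inv_into A g (g a)) (inv_into A g (g b))"
      by (rule interchangeable_transfer[OF hereditary_iso_inv[OF g] gB[OF that(1)] gB[OF that(2)]])
    moreover have "inv_into A g (g a) = a" "inv_into A g (g b) = b"
      using bij that by (simp_all add: bij_betw_def)
    ultimately show False
      using large_separates[OF A(3) \<open>k \<noteq> l\<close> that(1,3,2,4)] by simp
  qed
  have "\<exists>l. \<exists>a\<in>A \<inter> E i. g a \<in> E l" if i: "i < m" for i
  proof -
    obtain a where a: "a \<in> A \<inter> E i" using large_meets_block[OF A(3) i] by blast
    then have "g a \<in> base R" using gB B(1) by blast
    then obtain l where "g a \<in> E l" by (rule obtain_block)
    then show ?thesis using a by blast
  qed
  then obtain \<pi> where \<pi>: "\<And>i. i < m \<Longrightarrow> \<exists>a\<in>A \<inter> E i. g a \<in> E (\<pi> i)" by metis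
  have image: "g ` (A \<inter> E i) = B \<inter> E (\<pi> i)" if i: "i < m" for i
  proof
    obtain a where a: "a \<in> A" "a \<in> E i" "g a \<in> E (\<pi> i)" using \<pi>[OF i] by blast
    show "g ` (A \<inter> E i) \<subseteq> B \<inter> E (\<pi> i)"
    proof
      fix c assume "c \<in> g ` (A \<inter> E i)"
      then obtain b where b: "b \<in> A" "b \<in> E i" "c = g b" by blast
      obtain l where "g b \<in> E l" using obtain_block gB[OF b(1)] B(1) by blast
      then show "c \<in> B \<inter> E (\<pi> i)" using forward[OF a(1) b(1) a(2) b(2) a(3)] b gB by blast
    qed
    show "B \<inter> E (\<pi> i) \<subseteq> g ` (A \<inter> E i)"
    proof
      fix c assume c: "c \<in> B \<inter> E (\<pi> i)"
      then obtain b where b: "b \<in> A" "c = g b" using bij by (auto simp: bij_betw_def)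
      obtain l where l: "b \<in> E l" using obtain_block b(1) A(1) by blast
      have "i = l" using backward[OF a(1) b(1) a(2) l a(3)] b c by blast
      then show "c \<in> g ` (A \<inter> E i)" using b l by blast
    qed
  qed
  have inj: "inj_on \<pi> {..<m}"
  proof (rule inj_onI)
    fix i j assume ij: "i \<in> {..<m}" "j \<in> {..<m}" "\<pi> i = \<pi> j"
    then obtain a b where "a \<in> A" "a \<in> E i" "g a \<in> E (\<pi> i)" "b \<in> A" "b \<in> E j" "g b \<in> E (\<pi> j)"
      using \<pi>[of i] \<pi>[of j] by blast
    then show "i = j" using backward[of a b i j "\<pi> i"] ij by simp
  qed
  have "\<pi> ` {..<m} \<subseteq> {..<m}"
    using \<pi> block_less by blast
  then have "bij_betw \<pi> {..<m} {..<m}"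
    using inj by (simp add: bij_betw_def endo_inj_surj)
  moreover have "shape B (\<pi> i) = shape A i" if i: "i < m" for i
  proof -
    have "inj_on g (A \<inter> E i)" using bij by (auto simp: bij_betw_def intro: inj_on_subset)
    then have "card (g ` (A \<inter> E i)) = card (A \<inter> E i)" by (rule card_image)
    then show ?thesis by (simp add: shape_def image[OF i])
  qed
  ultimately show ?thesis using that by blast
qed

text \<open>The shape of \<open>B\<close> is that of \<open>A\<close> composed with a map on the block numbers.\<close>

lemma card_large_shapes_le:
  assumes A: "A \<subseteq> base R" "finite A" "large A"
  shows "finite (shape ` {B. B \<subseteq> base R \<and> finite B \<and> large B \<and> iso_on R A B})"
    "card (shape ` {B. B \<subseteq> base R \<and> finite B \<and> large B \<and> iso_on R A B}) \<le> m ^ m"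
proof -
  let ?X = "shape ` {B. B \<subseteq> base R \<and> finite B \<and> large B \<and> iso_on R A B}"
  let ?P = "{..<m} \<rightarrow>\<^sub>E {..<m}"
  define h where "h \<sigma> = (\<lambda>j. if j < m then shape A (\<sigma> j) else 0)" for \<sigma>
  have sub: "?X \<subseteq> h ` ?P"
  proof
    fix d assume "d \<in> ?X"
    then obtain B where B: "B \<subseteq> base R" "finite B" "large B" "iso_on R A B" "d = shape B" by blast
    obtain \<pi> where \<pi>: "bij_betw \<pi> {..<m} {..<m}" "\<And>i. i < m \<Longrightarrow> shape B (\<pi> i) = shape A i"
      by (rule large_iso_permutes_shape[OF A B(1-4)]) blast
    define \<sigma> where "\<sigma> = restrict (inv_into {..<m} \<pi>) {..<m}"
    have inv: "inv_into {..<m} \<pi> j < m" "\<pi> (inv_into {..<m} \<pi> j) = j" if "j < m" for j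
      using bij_betw_inv_into[OF \<pi>(1)] that bij_betw_inv_into_right[OF \<pi>(1), of j]
      by (auto simp: bij_betw_def)
    have "\<sigma> \<in> ?P" using inv by (auto simp: \<sigma>_def)
    moreover have "d = h \<sigma>"
    proof
      fix j
      show "d j = h \<sigma> j"
      proof (cases "j < m")
        case True
        then show ?thesis using \<pi>(2)[OF inv(1)[OF True]] inv(2)[OF True] B(5)
          by (simp add: h_def \<sigma>_def)
      next
        case False
        then show ?thesis using B(5) shape_eq_0[of j B] by (simp add: h_def)
      qed
    qed
    ultimately show "d \<in> h ` ?P" by blast
  qed
  have fin: "finite ?P" by (simp add: finite_PiE)
  then show "finite ?X" using sub by (meson finite_imageI finite_subset)
  have "card ?X \<le> card (h ` ?P)" using sub fin by (intro card_mono) auto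
  also have "\<dots> \<le> card ?P" by (rule card_image_le[OF fin])
  also have "\<dots> = m ^ m" by (simp add: card_PiE)
  finally show "card ?X \<le> m ^ m" .
qed

text \<open>Above the threshold \<open>W\<close>, all but one of the infinite blocks receive arbitrary numbers of extra points, up to
  a constant fraction of \<open>n\<close>, and the block \<open>i0\<close> receives what is left. This gives about \<open>n ^ (k - 1)\<close> large
  shapes of size \<open>n\<close>, at most \<open>m ^ m\<close> of which share an isomorphism type.\<close>

lemma profile_lower_bound:
  assumes k: "k = card {i. i < m \<and> infinite (E i)}" "k > 0"
    and fin: "\<And>n. finite (isomorphism_types R n)"
  shows "\<exists>c>0. \<forall>\<^sub>F n in sequentially. c * real n ^ (k - 1) \<le> real (profile R n)"
proof -
  define J where "J = {i. i < m \<and> infinite (E i)}"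
  have J: "finite J" "card J = k" "J \<subseteq> {..<m}" using k by (auto simp: J_def)
  then obtain i0 where i0: "i0 \<in> J" using k(2) by (metis card.empty ex_in_conv less_irrefl)
  obtain W where W: "W \<subseteq> base R" "finite W"
    and large: "\<And>A. A \<subseteq> base R \<Longrightarrow> finite A \<Longrightarrow> (\<And>l. shape W l \<le> shape A l) \<Longrightarrow> large A"
    using ex_large_threshold by blast
  \<comment> \<open>At least half of the \<open>n\<close> points are left to be distributed over the infinite blocks.\<close>
  have bound: "real n ^ (k - 1) \<le> (2 * real k) ^ (k - 1) * (real (m ^ m) * real (profile R n))"
    if n: "2 * card W \<le> n" for n
  proof -
    define r where "r = n - card W"
    define q where "q = r div k"
    define V where "V = (J - {i0}) \<rightarrow>\<^sub>E {..q}"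
    define sh where "sh v = (\<lambda>i. shape W i + (if i = i0 then r - (\<Sum>j\<in>J - {i0}. v j)
      else if i \<in> J then v i else 0))" for v :: "nat \<Rightarrow> nat"
    have sum_sh: "(\<Sum>i<m. sh v i) = n" if v: "v \<in> V" for v
    proof -
      have "(\<Sum>j\<in>J - {i0}. v j) \<le> (\<Sum>j\<in>J - {i0}. q)"
        using v by (intro sum_mono) (auto simp: V_def PiE_iff)
      also have "\<dots> \<le> k * q" using J by (simp add: card_Diff_subset i0)
      also have "\<dots> \<le> r" by (simp add: q_def)
      finally have le: "(\<Sum>j\<in>J - {i0}. v j) \<le> r" .
      let ?f = "\<lambda>i. if i = i0 then r - (\<Sum>j\<in>J - {i0}. v j) else if i \<in> J then v i else 0"
      have "(\<Sum>i<m. ?f i) = (\<Sum>i\<in>J. ?f i)"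
        using J(3) i0 by (intro sum.mono_neutral_right) auto
      also have "\<dots> = ?f i0 + (\<Sum>i\<in>J - {i0}. ?f i)" by (rule sum.remove[OF J(1) i0])
      also have "(\<Sum>i\<in>J - {i0}. ?f i) = (\<Sum>j\<in>J - {i0}. v j)" by (rule sum.cong) auto
      finally have "(\<Sum>i<m. ?f i) = r" using le by simp
      then show ?thesis
        using sum_shape[OF W] n by (simp add: sh_def sum.distrib r_def)
    qed
    have "\<exists>A. A \<subseteq> base R \<and> finite A \<and> shape A = sh v" for v
    proof -
      have "infinite (E i) \<or> sh v i \<le> card (E i)" for i
      proof (cases "i \<in> J")
        case False
        then have "sh v i = shape W i" using i0 by (auto simp: sh_def)
        then show ?thesis using shape_admissible[of i W] by simp
      qed (simp add: J_def)
      then show ?thesis using ex_set_of_shape[of "sh v"] by blast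
    qed
    then obtain S where S: "\<And>v. S v \<subseteq> base R" "\<And>v. finite (S v)" "\<And>v. shape (S v) = sh v" by metis
    have Slarge: "large (S v)" for v
      by (rule large[OF S(1,2)]) (simp add: S(3) sh_def)
    have size: "S v \<in> subsets_of_size R n" if "v \<in> V" for v
      using sum_shape[OF S(1,2), of v] sum_sh[OF that] S by (simp add: subsets_of_size_def)
    have inj: "inj_on sh V"
    proof (rule inj_onI)
      fix u v assume u: "u \<in> V" and v: "v \<in> V" and eq: "sh u = sh v"
      show "u = v"
      proof (rule PiE_ext[OF u[unfolded V_def] v[unfolded V_def]])
        fix i assume "i \<in> J - {i0}"
        then show "u i = v i" using fun_cong[OF eq, of i] by (simp add: sh_def)
      qed
    qed
    define f where "f v = same_type R n `` {S v}" for v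
    have finV: "finite V" unfolding V_def using J by (intro finite_PiE) auto
    have "card V \<le> m ^ m * card (isomorphism_types R n)"
    proof (rule card_le_fibres[OF fin _ _ finV])
      show "f ` V \<subseteq> isomorphism_types R n"
        using size by (auto simp: f_def isomorphism_types_def intro: quotientI)
      fix v assume v: "v \<in> V"
      let ?X = "shape ` {B. B \<subseteq> base R \<and> finite B \<and> large B \<and> iso_on R (S v) B}"
      have "sh ` {u \<in> V. f u = f v} \<subseteq> ?X"
      proof
        fix d assume "d \<in> sh ` {u \<in> V. f u = f v}"
        then obtain u where u: "u \<in> V" "f v = f u" "d = sh u" by auto
        have "(S v, S u) \<in> same_type R n"
          using eq_equiv_class[OF u(2)[unfolded f_def] equiv_same_type size[OF u(1)]] .
        then have "iso_on R (S v) (S u)" by (simp add: same_type_def)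
        then have "shape (S u) \<in> ?X" using S(1,2) Slarge by blast
        then show "d \<in> ?X" by (simp only: S(3) u(3))
      qed
      then have "card (sh ` {u \<in> V. f u = f v}) \<le> m ^ m"
        using card_large_shapes_le[OF S(1,2) Slarge, of v] card_mono le_trans by blast
      moreover have "card (sh ` {u \<in> V. f u = f v}) = card {u \<in> V. f u = f v}"
        by (rule card_image) (rule inj_on_subset[OF inj], blast)
      ultimately show "card {u \<in> V. f u = f v} \<le> m ^ m" by simp
    qed
    moreover have "card V = Suc q ^ (k - 1)"
      unfolding V_def using J i0 by (simp add: card_PiE card_Diff_subset)
    ultimately have "Suc q ^ (k - 1) \<le> m ^ m * profile R n" by (simp add: profile_def)
    then have le: "real (Suc q) ^ (k - 1) \<le> real (m ^ m) * real (profile R n)"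
      by (metis of_nat_le_iff of_nat_mult of_nat_power)
    have "r < k * Suc q" unfolding q_def using k(2) by (metis dividend_less_times_div mult_Suc_right)
    then have "n \<le> 2 * (k * Suc q)" using n by (simp add: r_def)
    then have "real n \<le> real (2 * (k * Suc q))" by (rule of_nat_mono)
    then have "real n \<le> (2 * real k) * real (Suc q)" by (simp only: of_nat_mult of_nat_numeral mult.assoc)
    then have "real n ^ (k - 1) \<le> ((2 * real k) * real (Suc q)) ^ (k - 1)" by (rule power_mono) simp
    also have "\<dots> = (2 * real k) ^ (k - 1) * real (Suc q) ^ (k - 1)" by (rule power_mult_distrib)
    also have "\<dots> \<le> (2 * real k) ^ (k - 1) * (real (m ^ m) * real (profile R n))"
      by (rule mult_left_mono[OF le]) simp
    finally show ?thesis .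
  qed
  let ?C = "(2 * real k) ^ (k - 1) * real (m ^ m)"
  have "m > 0" using i0 J by auto
  then have C: "?C > 0" using k(2) by simp
  have "(1 / ?C) * real n ^ (k - 1) \<le> real (profile R n)" if "2 * card W \<le> n" for n
  proof -
    have "real n ^ (k - 1) \<le> ?C * real (profile R n)" using bound[OF that] by (simp only: mult.assoc)
    then have "real n ^ (k - 1) / ?C \<le> real (profile R n)"
      using C by (simp only: pos_divide_le_eq mult.commute)
    then show ?thesis by simp
  qed
  then have "\<forall>\<^sub>F n in sequentially. (1 / ?C) * real n ^ (k - 1) \<le> real (profile R n)"
    unfolding eventually_sequentially by blast
  moreover have "1 / ?C > 0" using C by simp
  ultimately show ?thesis by blast
qed

end

section \<open>The profile of a structure with a finite monomorphic decomposition\<close>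

lemma obtain_minimal_indexed_decomposition:
  assumes "monomorphic_decomposition R D" "finite D"
  obtains E m where "minimal_indexed_decomposition R E m"
    "card {i. i < m \<and> infinite (E i)} = monomorphic_dimension R"
proof -
  define B where "B = interchange_classes R"
  have finB: "finite B" unfolding B_def by (rule finite_interchange_classes[OF assms])
  note part = partition_interchange_classes[of R, folded B_def]
  obtain e where e: "bij_betw e {0..<card B} B" using ex_bij_betw_nat_finite[OF finB] by blast
  define E where "E i = (if i < card B then e i else {})" for i
  have EB: "E i \<in> B" if "i < card B" for i using bij_betwE[OF e] that by (simp add: E_def)
  have Ee: "E i = e i" if "i < card B" for i using that by (simp add: E_def)
  have BE: "\<exists>i<card B. C = E i" if C: "C \<in> B" for C
  proof -
    have "C \<in> e ` {0..<card B}" using C e by (simp add: bij_betw_def)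
    then show ?thesis using Ee by auto
  qed
  have inj: "i = j" if "i < card B" "j < card B" "E i = E j" for i j
    using that e by (simp add: Ee bij_betw_def inj_on_def)
  have less: "i < card B" if "x \<in> E i" for x i using that by (cases "i < card B") (simp_all add: E_def)
  have "minimal_indexed_decomposition R E (card B)"
  proof
    show "E i \<inter> E j = {}" if "i \<noteq> j" for i j
    proof (rule ccontr)
      assume "E i \<inter> E j \<noteq> {}"
      then obtain x where x: "x \<in> E i" "x \<in> E j" by blast
      have "E i = E j" by (rule partition_on_unique_block[OF part x EB[OF less[OF x(1)]] EB[OF less[OF x(2)]]])
      then show False using inj less x that by blast
    qed
    show "(\<Union>i. E i) = base R"
    proof
      show "(\<Union>i. E i) \<subseteq> base R" using EB less partition_onD1[OF part] by blast
      show "base R \<subseteq> (\<Union>i. E i)"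
      proof
        fix x assume "x \<in> base R"
        then obtain C where C: "C \<in> B" "x \<in> C" using partition_onD1[OF part] by blast
        then show "x \<in> (\<Union>i. E i)" using BE[OF C(1)] by blast
      qed
    qed
    show "E i = {} \<longleftrightarrow> card B \<le> i" for i
      using EB[of i] partition_onD3[OF part] by (cases "i < card B") (auto simp: E_def)
    show "iso_on R A A'" if A: "A \<subseteq> base R" "finite A" "A' \<subseteq> base R" "finite A'"
      "\<And>i. card (A \<inter> E i) = card (A' \<inter> E i)" for A A'
    proof (rule monomorphic_decompositionD(2)[OF monomorphic_interchange_classes A(1-4)])
      fix C assume "C \<in> interchange_classes R"
      then obtain i where "C = E i" using BE unfolding B_def by blast
      then show "card (A \<inter> C) = card (A' \<inter> C)" using A(5) by simp
    qed
    show "\<not> interchangeable R (base R) x y" if ij: "i \<noteq> j" and x: "x \<in> E i" and y: "y \<in> E j" for i j x y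
    proof
      assume "interchangeable R (base R) x y"
      then have "E i = E j"
        using interchange_classes_distinct[OF _ _ x y] EB[OF less[OF x]] EB[OF less[OF y]]
        unfolding B_def by blast
      then show False using inj[OF less[OF x] less[OF y]] ij by simp
    qed
  qed
  moreover have "card {i. i < card B \<and> infinite (E i)} = monomorphic_dimension R"
  proof -
    have "E ` {i. i < card B \<and> infinite (E i)} = {C \<in> B. infinite C}"
    proof
      show "E ` {i. i < card B \<and> infinite (E i)} \<subseteq> {C \<in> B. infinite C}" using EB by auto
      show "{C \<in> B. infinite C} \<subseteq> E ` {i. i < card B \<and> infinite (E i)}"
      proof
        fix C assume C: "C \<in> {C \<in> B. infinite C}"
        then obtain i where "i < card B" "C = E i" using BE[of C] by auto
        then show "C \<in> E ` {i. i < card B \<and> infinite (E i)}" using C by auto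
      qed
    qed
    moreover have "inj_on E {i. i < card B \<and> infinite (E i)}" using inj by (auto intro: inj_onI)
    ultimately show ?thesis
      unfolding monomorphic_dimension_def minimal_decomposition_eq B_def[symmetric]
      by (metis card_image)
  qed
  ultimately show ?thesis by (rule that)
qed

text \<open>A layer above the sizes of all finite blocks consists of infinite blocks.\<close>

lemma (in indexed_decomposition) profile_series_rational:
  shows "is_polynomial (Abs_fps (\<lambda>n. int (profile R n)) *
    (\<Prod>i=1..card {i. i < m \<and> infinite (E i)}. 1 - fps_X ^ i))"
proof -
  let ?J = "{i. i < m \<and> infinite (E i)}"
  \<comment> \<open>Infinite blocks have cardinality \<open>0\<close>, so only the finite ones contribute.\<close>
  define K where "K = (\<Sum>i<m. card (E i))"
  have K: "d i \<le> K" if d: "leading d" and i: "i \<notin> ?J" for d i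
  proof -
    obtain A where A: "shape A = d" using d unfolding leading_def by blast
    show ?thesis
    proof (cases "i < m")
      case True
      then have "d i \<le> card (E i)" using shape_admissible[of i A] A i by auto
      also have "\<dots> \<le> K" unfolding K_def using True by (intro member_le_sum) auto
      finally show ?thesis .
    qed (use A shape_eq_0[of i A] in auto)
  qed
  have "is_polynomial (counting_series (\<lambda>d. \<Sum>i<m. d i) {d. leading d} *
      (\<Prod>i=1..card ?J. 1 - fps_X ^ i))"
  proof (rule counting_series_layered)
    fix d assume "d \<in> {d. leading d}"
    then have d: "leading d" by simp
    then obtain A where A: "shape A = d" unfolding leading_def by blast
    show "d i = 0" if "m \<le> i" for i using shape_eq_0[OF that, of A] A by simp
    show "d i \<le> K" if "i \<notin> ?J" for i by (rule K[OF d that])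
    show "raise (layer t d) d \<in> {d. leading d}" if t: "K < t" for t
    proof -
      have "infinite (E i)" if "i \<in> layer t d" for i
      proof -
        have "\<not> d i \<le> K" using that t by (simp add: layer_def)
        then show ?thesis using K[OF d, of i] by blast
      qed
      then have "leading (raise (layer t d) d)" using t by (intro leading_raise_layer[OF d]) auto
      then show ?thesis by simp
    qed
  qed blast
  then show ?thesis by (simp add: counting_series_def profile_eq_card_leading)
qed

theorem theorem1p7:
  fixes R :: "('a, 'i) structure_data" and k :: nat
  assumes "relational_structure R"
    and "infinite (base R)"
    and "\<exists>D. monomorphic_decomposition R D \<and> finite D"
    and "k = monomorphic_dimension R"
  shows "(\<exists>P :: int poly. poly P 1 \<noteq> 0 \<and>
            profile_series R =
              fps_of_poly (map_poly of_int P) / (\<Prod>i=1..k. (1 - fps_X ^ i)))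
       \<and> eventually_quasi_polynomial (k - 1) (profile R)
       \<and> (\<exists>a::real. a > 0 \<and>
            (\<lambda>n. real (profile R n)) \<sim>[at_top] (\<lambda>n. a * real n ^ (k - 1)))"
proof -
  obtain D where D: "monomorphic_decomposition R D" "finite D" using assms(3) by blast
  obtain E m where E: "minimal_indexed_decomposition R E m"
    and k: "k = card {i. i < m \<and> infinite (E i)}"
    using obtain_minimal_indexed_decomposition[OF D] assms(4) by metis
  interpret minimal_indexed_decomposition R E m by (rule E)
  have "k > 0"
  proof (rule ccontr)
    assume "\<not> k > 0"
    then have "{i. i < m \<and> infinite (E i)} = {}" using k by simp
    then have "finite (E i)" for i using empty_iff[of i] by (cases "i < m") auto
    moreover have "base R \<subseteq> (\<Union>i<m. E i)" using obtain_block by blast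
    ultimately show False using assms(2) by (meson finite_UN finite_lessThan finite_subset)
  qed
  then obtain r where r: "k = Suc r" by (metis gr0_implies_Suc)
  obtain P where P: "Abs_fps (\<lambda>n. int (profile R n)) * (\<Prod>i=1..k. 1 - fps_X ^ i) = fps_of_poly P"
    using profile_series_rational unfolding k[symmetric] by (elim imageE)
  obtain c where c: "c > 0" "\<forall>\<^sub>F n in sequentially. c * real n ^ (k - 1) \<le> real (profile R n)"
    using profile_lower_bound[OF k \<open>k > 0\<close> finite_isomorphism_types[OF D]] by (elim exE conjE)
  note growth = rational_series_growth[OF P[unfolded r] c[unfolded r diff_Suc_1]]
  have "profile_series R = fps_of_poly (map_poly of_int P) / (\<Prod>i=1..k. 1 - fps_X ^ i)"
    unfolding profile_series_def by (rule int_series_eq_divide[OF P])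
  moreover have "poly P 1 \<noteq> 0" by (rule growth(1))
  moreover have "eventually_quasi_polynomial (k - 1) (profile R)"
    unfolding r diff_Suc_1 by (rule growth(2))
  moreover have "\<exists>a>0. (\<lambda>n. real (profile R n)) \<sim>[at_top] (\<lambda>n. a * real n ^ (k - 1))"
    unfolding r diff_Suc_1 by (rule growth(3))
  ultimately show ?thesis by blast
qed

end
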